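(* Let $\Omega$ be a bounded domain in $\mathbb{C}^n$ such that $A(\Omega)$ is strongly bpwl-dense in $H^\infty(\Omega)$. Let $\mathcal{R}$ be a finite-rank quasi-free Hilbert module over $A(\Omega)$ and let $\varphi\in H^\infty(\Omega)$, $\varphi\ne0$. A necessary condition for $M_\varphi$ to have closed range is that $\hat\varphi|_{X^\infty_{\mathcal{R}}}$ be invertible in $C(X^\infty_{\mathcal{R}})$.
   Context: $A(\Omega)$ is the function algebra obtained as the supremum-norm completion of the set of functions holomorphic in some neighborhood of $\overline{\Omega}$. Let $\ell^2_m$ be the $m$-dimensional Hilbert space. A quasi-free Hilbert module $\mathcal{R}$ of rank $m$ over $A(\Omega)$ is the completion of an inner product on the algebraic tensor product $A(\Omega)\otimes\ell^2_m$ such that: (1) for each $z\in\Omega$ the evaluation map $\mathrm{eval}_z:A(\Omega)\otimes\ell^2_m\to\ell^2_m$, $\theta\otimes x\mapsto\theta(z)x$, is bounded, and these maps are locally uniformly bounded on $\Omega$; (2) $\|\sum\varphi\theta_i\otimes x_i\|_{\mathcal{R}}\le\|\varphi\|_{A(\Omega)}\|\sum\theta_i\otimes x_i\|_{\mathcal{R}}$ for $\varphi,\theta_i\in A(\Omega)$, $x_i\in\ell^2_m$; (3) for every sequence $(F_i)$ in $A(\Omega)\otimes\ell^2_m$ that is Cauchy in the $\mathcal{R}$-norm, $\mathrm{eval}_z(F_i)\to0$ for all $z\in\Omega$ if and only if $\|F_i\|_{\mathcal{R}}\to0$. Finite rank means $m<\infty$. Via the continuous extensions $\mathrm{eval}_z:\mathcal{R}\to\ell^2_m$,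 elements $f\in\mathcal{R}$ are regarded as $\ell^2_m$-valued holomorphic functions $f(z)=\mathrm{eval}_zf$ on $\Omega$. $H^\infty(\Omega)$ is the algebra of bounded holomorphic functions on $\Omega$ with the supremum norm, and $\hat\varphi$ is the Gelfand transform of $\varphi$ on its maximal ideal space $M_{H^\infty(\Omega)}$. $A(\Omega)$ is strongly bpwl-dense in $H^\infty(\Omega)$ if for every $\varphi\in H^\infty(\Omega)$ there is a sequence $(\varphi_i)$ in $A(\Omega)$ with $\|\varphi_i\|_{A(\Omega)}\le\|\varphi\|_{H^\infty(\Omega)}$ for all $i$ and $\varphi_i(z)\to\varphi(z)$ for all $z\in\Omega$. In that case $\mathcal{R}$ is a contractive Hilbert module over $H^\infty(\Omega)$: for $\varphi\in H^\infty(\Omega)$, $M_\varphi f=\varphi f$ defines an operator on $\mathcal{R}$ with $\|M_\varphi\|\le\|\varphi\|_{H^\infty(\Omega)}$. $\mathfrak{T}_\infty(\mathcal{R})$ is the C*-algebra generated by $\{M_\varphi:\varphi\in H^\infty(\Omega)\}$ and $\mathfrak{C}_\infty(\mathcal{R})$ its commutator ideal (the closed two-sided ideal generated by commutators). $X^\infty_{\mathcal{R}}$ is the compact space of characters of $\mathfrak{T}_\infty(\mathcal{R})$, so that $\mathfrak{T}_\infty(\mathcal{R})/\mathfrak{C}_\infty(\mathcal{R})\simeq C(X^\infty_{\mathcal{R}})$; it is identified with a subset of $M_{H^\infty(\Omega)}$ by sending a character $\chi$ to $\varphi\mapsto\chi(M_\varphi)$. *)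

theory Defs
  imports "HOL-Analysis.Analysis"
begin

section \<open>Complex Hilbert spaces\<close>

text \<open>The libraries only provide real inner product spaces.  A complex Hilbert space is rendered
  as a complete one that carries a complex scalar multiplication and a sesquilinear form (linear
  in the first argument) whose real part is the real inner product; norm and topology are thus
  the usual ones.\<close>

class chilbert_space = real_inner + complete_space +
  fixes scaleC :: "complex \<Rightarrow> 'a \<Rightarrow> 'a" (infixr \<open>*\<^sub>C\<close> 75)
    and cinner :: "'a \<Rightarrow> 'a \<Rightarrow> complex"
  assumes scaleC_add_right: "c *\<^sub>C (x + y) = c *\<^sub>C x + c *\<^sub>C y"
    and scaleC_add_left: "(c + d) *\<^sub>C x = c *\<^sub>C x + d *\<^sub>C x"
    and scaleC_scaleC: "c *\<^sub>C d *\<^sub>C x = (c * d) *\<^sub>C x"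
    and scaleC_of_real: "complex_of_real r *\<^sub>C x = r *\<^sub>R x"
    and cinner_add_left: "cinner (x + y) z = cinner x z + cinner y z"
    and cinner_scaleC_left: "cinner (c *\<^sub>C x) y = c * cinner x y"
    and cinner_commute: "cinner x y = cnj (cinner y x)"
    and inner_eq_Re_cinner: "inner x y = Re (cinner x y)"

instantiation complex :: chilbert_space
begin

definition scaleC_complex :: "complex \<Rightarrow> complex \<Rightarrow> complex"
  where "scaleC_complex c x = c * x"

definition cinner_complex :: "complex \<Rightarrow> complex \<Rightarrow> complex"
  where "cinner_complex x y = x * cnj y"

instance
  by standard
    (simp_all add: scaleC_complex_def cinner_complex_def inner_complex_def algebra_simps scaleR_conv_of_real)

end

lemma norm_scaleC: "norm (c *\<^sub>C x) = norm c * norm (x :: 'a::chilbert_space)"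
proof -
  have "cinner (c *\<^sub>C x) (c *\<^sub>C x) = c * cnj (c * cinner x x)"
    by (metis cinner_commute cinner_scaleC_left)
  also have "\<dots> = of_real ((norm c)\<^sup>2) * cinner x x"
    by (metis cinner_commute complex_cnj_mult complex_norm_square mult.assoc of_real_power)
  finally have "(norm (c *\<^sub>C x))\<^sup>2 = (norm c * norm x)\<^sup>2"
    by (simp add: power2_norm_eq_inner inner_eq_Re_cinner power_mult_distrib del: of_real_power)
  then show ?thesis
    by (simp add: power2_eq_iff_nonneg)
qed

lemma bounded_linear_scaleC: "bounded_linear (\<lambda>x :: 'a::chilbert_space. c *\<^sub>C x)"
proof (rule bounded_linear_intro)
  fix r and x :: 'a
  show "c *\<^sub>C r *\<^sub>R x = r *\<^sub>R c *\<^sub>C x"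
    by (metis scaleC_of_real scaleC_scaleC mult.commute)
  show "norm (c *\<^sub>C x) \<le> norm x * norm c"
    by (simp add: norm_scaleC)
qed (rule scaleC_add_right)

lift_definition scalar_op :: "complex \<Rightarrow> 'a::chilbert_space \<Rightarrow>\<^sub>L 'a"
  is "\<lambda>c x. c *\<^sub>C x"
  by (rule bounded_linear_scaleC)

definition cadjoint :: "('a::chilbert_space \<Rightarrow>\<^sub>L 'a) \<Rightarrow> 'a \<Rightarrow>\<^sub>L 'a"
  where "cadjoint T = (THE S :: 'a \<Rightarrow>\<^sub>L 'a. \<forall>x y. cinner (T x) y = cinner x (S y))"

text \<open>The type \<open>'a \<Rightarrow>\<^sub>L 'a\<close> consists of the bounded \<^emph>\<open>real\<close>-linear operators, whence the explicit
  complex-linearity.\<close>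

definition cstar_operator_algebra :: "('a::chilbert_space \<Rightarrow>\<^sub>L 'a) set \<Rightarrow> bool"
  where "cstar_operator_algebra B \<longleftrightarrow>
    (\<forall>T\<in>B. \<forall>c x. T (c *\<^sub>C x) = c *\<^sub>C T x) \<and>
    0 \<in> B \<and>
    (\<forall>S\<in>B. \<forall>T\<in>B. S + T \<in> B \<and> S o\<^sub>L T \<in> B) \<and>
    (\<forall>c. \<forall>T\<in>B. scalar_op c o\<^sub>L T \<in> B) \<and>
    (\<forall>T\<in>B. cadjoint T \<in> B) \<and>
    closed B"

section \<open>Characters\<close>

text \<open>Characters of a complex algebra with carrier \<open>A\<close> and operations \<open>add\<close>, \<open>mul\<close>, \<open>sc\<close>.  They are
  extended by zero off \<open>A\<close>, so that the product topology on the type \<open>'a \<Rightarrow> complex\<close> restricts to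
  the topology of pointwise convergence on \<open>A\<close>, i.e. to the Gelfand (weak-star) topology.\<close>

definition characters ::
  "'a set \<Rightarrow> ('a \<Rightarrow> 'a \<Rightarrow> 'a) \<Rightarrow> ('a \<Rightarrow> 'a \<Rightarrow> 'a) \<Rightarrow> (complex \<Rightarrow> 'a \<Rightarrow> 'a) \<Rightarrow> ('a \<Rightarrow> complex) set"
  where "characters A add mul sc = {h.
    (\<forall>a\<in>A. \<forall>b\<in>A. h (add a b) = h a + h b) \<and>
    (\<forall>a\<in>A. \<forall>b\<in>A. h (mul a b) = h a * h b) \<and>
    (\<forall>c. \<forall>a\<in>A. h (sc c a) = c * h a) \<and>
    (\<exists>a\<in>A. h a \<noteq> 0) \<and>
    (\<forall>a. a \<notin> A \<longrightarrow> h a = 0)}"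

definition invertible_in_C :: "'a::topological_space set \<Rightarrow> ('a \<Rightarrow> complex) \<Rightarrow> bool"
  where "invertible_in_C X f \<longleftrightarrow>
    continuous_on X f \<and> (\<exists>g. continuous_on X g \<and> (\<forall>x\<in>X. f x * g x = 1))"

section \<open>Function algebras on domains in several complex variables\<close>

definition bounded_domain :: "(complex^'n) set \<Rightarrow> bool"
  where "bounded_domain \<Omega> \<longleftrightarrow> open \<Omega> \<and> connected \<Omega> \<and> \<Omega> \<noteq> {} \<and> bounded \<Omega>"

definition holomorphic_several :: "(complex^'n \<Rightarrow> complex) \<Rightarrow> (complex^'n) set \<Rightarrow> bool"
  where "holomorphic_several f U \<longleftrightarrow>
    (\<forall>z\<in>U. \<exists>D. (f has_derivative D) (at z) \<and> (\<forall>c v. D (c *s v) = c * D v))"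

definition sup_norm :: "'a set \<Rightarrow> ('a \<Rightarrow> complex) \<Rightarrow> real"
  where "sup_norm S f = (SUP z\<in>S. norm (f z))"

text \<open>Functions on a set are represented by their extensions by zero.  The completion is taken
  inside the bounded functions on \<open>closure \<Omega>\<close>.\<close>

definition A_alg :: "(complex^'n) set \<Rightarrow> (complex^'n \<Rightarrow> complex) set"
  where "A_alg \<Omega> = {f. (\<forall>z. z \<notin> closure \<Omega> \<longrightarrow> f z = 0) \<and>
    (\<forall>e>0. \<exists>U g. open U \<and> closure \<Omega> \<subseteq> U \<and> holomorphic_several g U \<and>
       (\<forall>z\<in>closure \<Omega>. norm (f z - g z) < e))}"

definition H_inf :: "(complex^'n) set \<Rightarrow> (complex^'n \<Rightarrow> complex) set"
  where "H_inf \<Omega> = {f. (\<forall>z. z \<notin> \<Omega> \<longrightarrow> f z = 0) \<and> holomorphic_several f \<Omega> \<and> bounded (f ` \<Omega>)}"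

definition strongly_bpwl_dense :: "(complex^'n) set \<Rightarrow> bool"
  where "strongly_bpwl_dense \<Omega> \<longleftrightarrow> (\<forall>\<phi>\<in>H_inf \<Omega>. \<exists>s :: nat \<Rightarrow> complex^'n \<Rightarrow> complex.
    (\<forall>i. s i \<in> A_alg \<Omega> \<and> sup_norm (closure \<Omega>) (s i) \<le> sup_norm \<Omega> \<phi>) \<and>
    (\<forall>z\<in>\<Omega>. (\<lambda>i. s i z) \<longlonglongrightarrow> \<phi> z))"

definition max_ideal_space_H_inf :: "(complex^'n) set \<Rightarrow> ((complex^'n \<Rightarrow> complex) \<Rightarrow> complex) set"
  where "max_ideal_space_H_inf \<Omega> =
    characters (H_inf \<Omega>) (\<lambda>f g z. f z + g z) (\<lambda>f g z. f z * g z) (\<lambda>c f z. c * f z)"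

definition gelfand ::
  "(complex^'n) set \<Rightarrow> (complex^'n \<Rightarrow> complex) \<Rightarrow> ((complex^'n \<Rightarrow> complex) \<Rightarrow> complex) \<Rightarrow> complex"
  where "gelfand \<Omega> \<phi> = restrict (\<lambda>\<psi>. \<psi> \<phi>) (max_ideal_space_H_inf \<Omega>)"

section \<open>Quasi-free Hilbert modules\<close>

text \<open>The algebraic tensor product of \<open>A_alg \<Omega>\<close> with the Hilbert space \<open>complex^'m\<close>, realised as a
  space of vector-valued functions: the elementary tensor of \<open>\<theta>\<close> and \<open>x\<close> is \<open>\<lambda>z. \<theta> z *s x\<close>.  Under
  this (faithful) realisation, evaluation at \<open>z\<close> is \<open>F \<mapsto> F z\<close>.\<close>

definition A_tensor :: "(complex^'n) set \<Rightarrow> (complex^'n \<Rightarrow> complex^'m) set"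
  where "A_tensor \<Omega> = {F. \<exists>(k::nat) \<theta> x. (\<forall>i<k. \<theta> i \<in> A_alg \<Omega>) \<and> F = (\<lambda>z. \<Sum>i<k. \<theta> i z *s x i)}"

definition inner_product_on ::
  "('a \<Rightarrow> complex^'m) set \<Rightarrow> (('a \<Rightarrow> complex^'m) \<Rightarrow> ('a \<Rightarrow> complex^'m) \<Rightarrow> complex) \<Rightarrow> bool"
  where "inner_product_on V ip \<longleftrightarrow>
    (\<forall>F\<in>V. \<forall>G\<in>V. \<forall>H\<in>V. ip (\<lambda>z. F z + G z) H = ip F H + ip G H) \<and>
    (\<forall>c. \<forall>F\<in>V. \<forall>G\<in>V. ip (\<lambda>z. c *s F z) G = c * ip F G) \<and>
    (\<forall>F\<in>V. \<forall>G\<in>V. ip F G = cnj (ip G F)) \<and>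
    (\<forall>F\<in>V. F \<noteq> (\<lambda>z. 0) \<longrightarrow> Re (ip F F) > 0)"

definition ip_norm :: "('f \<Rightarrow> 'f \<Rightarrow> complex) \<Rightarrow> 'f \<Rightarrow> real"
  where "ip_norm ip F = sqrt (Re (ip F F))"

definition is_completion ::
  "('a \<Rightarrow> complex^'m) set \<Rightarrow> (('a \<Rightarrow> complex^'m) \<Rightarrow> ('a \<Rightarrow> complex^'m) \<Rightarrow> complex)
    \<Rightarrow> (('a \<Rightarrow> complex^'m) \<Rightarrow> 'r::chilbert_space) \<Rightarrow> bool"
  where "is_completion V ip \<iota> \<longleftrightarrow>
    (\<forall>F\<in>V. \<forall>G\<in>V. \<iota> (\<lambda>z. F z + G z) = \<iota> F + \<iota> G) \<and>
    (\<forall>c. \<forall>F\<in>V. \<iota> (\<lambda>z. c *s F z) = c *\<^sub>C \<iota> F) \<and>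
    (\<forall>F\<in>V. \<forall>G\<in>V. cinner (\<iota> F) (\<iota> G) = ip F G) \<and>
    closure (\<iota> ` V) = UNIV"

text \<open>The module is the type \<open>'r\<close>, together with the canonical map \<open>\<iota>\<close> from the algebraic tensor
  product onto a dense subspace.  Its rank is \<open>CARD('m)\<close>.\<close>

definition quasi_free_module ::
  "(complex^'n) set \<Rightarrow> ((complex^'n \<Rightarrow> complex^'m) \<Rightarrow> (complex^'n \<Rightarrow> complex^'m) \<Rightarrow> complex)
    \<Rightarrow> ((complex^'n \<Rightarrow> complex^'m) \<Rightarrow> 'r::chilbert_space) \<Rightarrow> bool"
  where "quasi_free_module \<Omega> ip \<iota> \<longleftrightarrow>
    inner_product_on (A_tensor \<Omega>) ip \<and>
    is_completion (A_tensor \<Omega>) ip \<iota> \<and>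
    (\<forall>z\<in>\<Omega>. \<exists>C. \<forall>F\<in>A_tensor \<Omega>. norm (F z) \<le> C * ip_norm ip F) \<and>
    (\<forall>z\<in>\<Omega>. \<exists>e>0. \<exists>C. \<forall>w\<in>ball z e \<inter> \<Omega>. \<forall>F\<in>A_tensor \<Omega>. norm (F w) \<le> C * ip_norm ip F) \<and>
    (\<forall>\<phi>\<in>A_alg \<Omega>. \<forall>F\<in>A_tensor \<Omega>.
       ip_norm ip (\<lambda>z. \<phi> z *s F z) \<le> sup_norm (closure \<Omega>) \<phi> * ip_norm ip F) \<and>
    (\<forall>F :: nat \<Rightarrow> complex^'n \<Rightarrow> complex^'m.
       (\<forall>i. F i \<in> A_tensor \<Omega>) \<and>
       (\<forall>e>0. \<exists>N. \<forall>i\<ge>N. \<forall>j\<ge>N. ip_norm ip (\<lambda>z. F i z - F j z) < e) \<longrightarrow>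
       ((\<forall>z\<in>\<Omega>. (\<lambda>i. F i z) \<longlonglongrightarrow> 0) \<longleftrightarrow> (\<lambda>i. ip_norm ip (F i)) \<longlonglongrightarrow> 0))"

text \<open>The continuous extension of the evaluation at \<open>z\<close> to the module.\<close>

definition module_eval ::
  "(complex^'n) set \<Rightarrow> ((complex^'n \<Rightarrow> complex^'m) \<Rightarrow> 'r::chilbert_space) \<Rightarrow> complex^'n
    \<Rightarrow> 'r \<Rightarrow> complex^'m"
  where "module_eval \<Omega> \<iota> z =
    (THE E. continuous_on UNIV E \<and> (\<forall>F\<in>A_tensor \<Omega>. E (\<iota> F) = F z))"

text \<open>The bounded operator \<open>f \<mapsto> \<phi> f\<close>, where module elements are regarded as functions on \<open>\<Omega>\<close>.
  It is well defined for \<open>\<phi> \<in> H_inf \<Omega>\<close> if \<open>strongly_bpwl_dense \<Omega>\<close>.\<close>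

definition mult_op ::
  "(complex^'n) set \<Rightarrow> ((complex^'n \<Rightarrow> complex^'m) \<Rightarrow> 'r::chilbert_space)
    \<Rightarrow> (complex^'n \<Rightarrow> complex) \<Rightarrow> 'r \<Rightarrow>\<^sub>L 'r"
  where "mult_op \<Omega> \<iota> \<phi> =
    (THE T :: 'r \<Rightarrow>\<^sub>L 'r. \<forall>f. \<forall>z\<in>\<Omega>. module_eval \<Omega> \<iota> z (T f) = \<phi> z *s module_eval \<Omega> \<iota> z f)"

definition toeplitz_algebra ::
  "(complex^'n) set \<Rightarrow> ((complex^'n \<Rightarrow> complex^'m) \<Rightarrow> 'r::chilbert_space) \<Rightarrow> ('r \<Rightarrow>\<^sub>L 'r) set"
  where "toeplitz_algebra \<Omega> \<iota> = cstar_operator_algebra hull (mult_op \<Omega> \<iota> ` H_inf \<Omega>)"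

text \<open>The character space of the Toeplitz algebra, as a subset of the maximal ideal space of
  \<open>H_inf \<Omega>\<close>.  The identification is a continuous injection of a compact space into a Hausdorff
  space, so the subspace topology is the Gelfand topology of the character space.\<close>

definition X_inf ::
  "(complex^'n) set \<Rightarrow> ((complex^'n \<Rightarrow> complex^'m) \<Rightarrow> 'r::chilbert_space)
    \<Rightarrow> ((complex^'n \<Rightarrow> complex) \<Rightarrow> complex) set"
  where "X_inf \<Omega> \<iota> =
    (\<lambda>h \<phi>. if \<phi> \<in> H_inf \<Omega> then h (mult_op \<Omega> \<iota> \<phi>) else 0) `
      characters (toeplitz_algebra \<Omega> \<iota>) (+) (o\<^sub>L) (\<lambda>c T. scalar_op c o\<^sub>L T)"

end

theory Submission
  imports Defs "HOL-Complex_Analysis.Complex_Analysis"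
begin

text \<open>
The zeros of \<open>\<phi>\<close> in \<open>\<Omega>\<close> have no interior points, and the elements of the module are continuous
functions, so that \<open>M\<^sub>\<phi>\<close> is injective (\<open>mult_op_injective\<close>).  If its range is closed, it is thus bounded below
(\<open>injective_closed_range_bounded_below\<close>), which makes \<open>M\<^sub>\<phi>\<^sup>* M\<^sub>\<phi>\<close> invertible.  The inverse is a norm
limit of polynomials in \<open>M\<^sub>\<phi>\<^sup>* M\<^sub>\<phi>\<close>, and so the Toeplitz algebra contains a left inverse \<open>S\<close> of \<open>M\<^sub>\<phi>\<close>
(\<open>left_inverse_in_cstar_operator_algebra\<close>).  For every character \<open>\<xi>\<close> of that algebra,
\<open>\<xi> S * \<xi> M\<^sub>\<phi> = \<xi> 1 = 1\<close>, so that the Gelfand transform of \<open>\<phi>\<close> has no zero on the character space.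
It is continuous there, being evaluation at \<open>\<phi>\<close> in the topology of pointwise convergence, and its
reciprocal is then continuous as well.

This uses that \<open>M\<^sub>\<phi>\<close> exists for bounded holomorphic \<open>\<phi>\<close>, is determined by \<open>\<phi>\<close>, and depends on it as an
algebra homomorphism.  Uniqueness and the algebraic identities hold because elements of the module
are determined by their values (\<open>ev_eq_0_imp\<close>); existence (\<open>H_inf_multiplier\<close>) is a weak limit of
multiplications by approximating functions in \<open>A(\<Omega>)\<close>.  One geometric fact about Hilbert spaces, that
nested closed convex sets with points of bounded norm intersect (\<open>nested_closed_convex\<close>), supplies
these weak limits, the Riesz representation behind the adjoint, and the closedness of images of
balls that reduces boundedness below to Baire's theorem.
\<close>

section \<open>Weak compactness in Hilbert spaces\<close>

instance chilbert_space \<subseteq> banach ..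

text \<open>Elements of almost minimal norm in the successive sets form a Cauchy sequence: the midpoint of two
of them stays in the larger set, so that its norm is not much smaller than theirs, and the
parallelogram law then makes their distance small.  This is the weak compactness of balls, in a
form that speaks of norms only.\<close>

lemma nested_closed_convex:
  fixes C :: "nat \<Rightarrow> 'a::{real_inner,complete_space} set"
  assumes closed: "\<And>n. closed (C n)" and convex: "\<And>n. convex (C n)" and dec: "decseq C"
    and meets: "\<And>n. \<exists>x\<in>C n. norm x \<le> K"
  shows "\<exists>x. \<forall>n. x \<in> C n"
proof -
  define d where "d n = Inf (norm ` C n)" for n
  have bdd: "bdd_below (norm ` C n)" for n
    by (rule bdd_belowI[of _ 0]) auto
  have d_le: "d n \<le> norm x" if "x \<in> C n" for n x
    unfolding d_def using that bdd by (auto intro: cInf_lower)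
  have d_nonneg: "0 \<le> d n" for n
    unfolding d_def using meets[of n] by (intro cInf_greatest) auto
  have "incseq d"
    unfolding d_def
  proof (intro incseq_SucI cInf_superset_mono bdd image_mono decseq_SucD[OF dec])
    show "norm ` C (Suc n) \<noteq> {}" for n
      using meets[of "Suc n"] by auto
  qed
  moreover have "d n \<le> K" for n
    using meets[of n] d_le by force
  ultimately obtain L where L: "d \<longlonglongrightarrow> L" "\<And>n. d n \<le> L"
    using incseq_convergent by blast
  have "\<exists>x\<in>C n. norm x < d n + inverse (Suc n)" for n
  proof -
    have "\<exists>r\<in>norm ` C n. r < d n + inverse (Suc n)"
      by (rule cInf_lessD) (use meets[of n] in \<open>auto simp: d_def\<close>)
    then show ?thesis by blast
  qed
  then obtain x where x: "\<And>n. x n \<in> C n" "\<And>n. norm (x n) < d n + inverse (Suc n)"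
    by metis
  \<comment> \<open>The parallelogram law bounds the distance of any later point from \<open>x n\<close> by \<open>e n\<close>.\<close>
  define e where "e n = sqrt (4 * (L + inverse (Suc n))\<^sup>2 - 4 * (d n)\<^sup>2)" for n
  have "(\<lambda>n. inverse (real (Suc n))) \<longlonglongrightarrow> 0"
    by (rule LIMSEQ_inverse_real_of_nat)
  then have "e \<longlonglongrightarrow> sqrt (4 * (L + 0)\<^sup>2 - 4 * L\<^sup>2)"
    unfolding e_def by (intro tendsto_intros L)
  then have e: "e \<longlonglongrightarrow> 0" by simp
  have close: "dist (x m) (x n) \<le> e n" if "n \<le> m" for m n
  proof -
    have "inverse (real (Suc m)) \<le> inverse (real (Suc n))"
      using that by (simp add: field_simps)
    then have bounds: "norm (x m) \<le> L + inverse (Suc n)" "norm (x n) \<le> L + inverse (Suc n)"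
      using x(2)[of m] x(2)[of n] L(2)[of m] L(2)[of n] by linarith+
    have "x m \<in> C n"
      using x(1)[of m] decseqD[OF dec that] by auto
    then have "(1/2) *\<^sub>R x m + (1/2) *\<^sub>R x n \<in> C n"
      using convexD[OF convex[of n], of "x m" "x n" "1/2" "1/2"] x(1)[of n] by simp
    then have "d n \<le> norm ((1/2) *\<^sub>R (x m + x n))"
      using d_le by (simp add: scaleR_add_right)
    then have mid: "2 * d n \<le> norm (x m + x n)" by simp
    have "(norm (x m - x n))\<^sup>2 = 2 * (norm (x m))\<^sup>2 + 2 * (norm (x n))\<^sup>2 - (norm (x m + x n))\<^sup>2"
      by (simp add: power2_norm_eq_inner algebra_simps inner_commute)
    moreover have "(norm (x m))\<^sup>2 \<le> (L + inverse (Suc n))\<^sup>2" "(norm (x n))\<^sup>2 \<le> (L + inverse (Suc n))\<^sup>2"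
      using bounds by (auto intro: power_mono)
    moreover have "(2 * d n)\<^sup>2 \<le> (norm (x m + x n))\<^sup>2"
      using mid d_nonneg[of n] by (intro power_mono) auto
    ultimately have "(norm (x m - x n))\<^sup>2 \<le> 4 * (L + inverse (Suc n))\<^sup>2 - 4 * (d n)\<^sup>2"
      by (simp add: power_mult_distrib)
    then show ?thesis
      unfolding e_def dist_norm by (rule real_le_rsqrt)
  qed
  have "Cauchy x"
    unfolding Cauchy_altdef2
  proof (intro allI impI)
    fix r :: real assume "r > 0"
    then obtain N where "e N < r"
      using order_tendstoD(2)[OF e] eventually_happens'[OF sequentially_bot] by blast
    then show "\<exists>N. \<forall>n\<ge>N. dist (x n) (x N) < r"
      using close by (meson le_less_trans)
  qed
  then obtain y where y: "x \<longlonglongrightarrow> y"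
    using Cauchy_convergent convergent_def by blast
  have "y \<in> C n" for n
  proof (rule closed_sequentially[OF closed])
    show "x (k + n) \<in> C n" for k
      using x(1)[of "k + n"] decseqD[OF dec, of n "k + n"] by auto
    show "(\<lambda>k. x (k + n)) \<longlonglongrightarrow> y"
      using y by (rule LIMSEQ_ignore_initial_segment)
  qed
  then show ?thesis by blast
qed

text \<open>The representing vector is the minimizer of \<open>J x = (norm x)\<^sup>2 - 2 * f x\<close>, where the derivative of
\<open>J\<close> in every direction vanishes.  A minimizer is a common point of the sublevel sets of the convex
function \<open>J\<close>.\<close>

lemma Riesz_representation:
  fixes f :: "'a::{real_inner,complete_space} \<Rightarrow> real"
  assumes f: "bounded_linear f"
  shows "\<exists>y. \<forall>x. f x = inner x y"
proof -
  interpret f: bounded_linear f by (rule f)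
  obtain K where K: "\<And>x. norm (f x) \<le> norm x * K" "K \<ge> 0"
    using f.nonneg_bounded by auto
  define J where "J x = (norm x)\<^sup>2 - 2 * f x" for x
  define d where "d = Inf (range J)"
  have J_ge: "(norm x - K)\<^sup>2 - K\<^sup>2 \<le> J x" for x
    using K(1)[of x] by (simp add: J_def power2_eq_square algebra_simps)
  have "- K\<^sup>2 \<le> J x" for x
    using J_ge[of x] zero_le_power2[of "norm x - K"] by linarith
  then have bdd: "bdd_below (range J)"
    by (auto intro: bdd_belowI[where m = "- K\<^sup>2"])
  then have d_le: "d \<le> J x" for x
    unfolding d_def by (auto intro: cInf_lower)
  define C where "C n = {x. J x \<le> d + inverse (real (Suc n))}" for n
  have "\<exists>y. \<forall>n. y \<in> C n"
  proof (rule nested_closed_convex[where K = "K + sqrt (d + 1 + K\<^sup>2)"])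
    fix n
    have "continuous_on UNIV J"
      unfolding J_def by (intro continuous_intros f.continuous_on)
    then show "closed (C n)"
      unfolding C_def by (intro closed_Collect_le) (auto intro: continuous_intros)
    show "convex (C n)"
    proof (rule convexI)
      fix x y and u v :: real
      assume xy: "x \<in> C n" "y \<in> C n" and uv: "0 \<le> u" "0 \<le> v" "u + v = 1"
      have v: "v = 1 - u" using uv by simp
      have "J (u *\<^sub>R x + v *\<^sub>R y) = u * J x + v * J y - u * v * (norm (x - y))\<^sup>2"
        unfolding J_def v f.add f.scaleR
        by (simp add: power2_norm_eq_inner inner_add_left inner_add_right inner_diff_left
            inner_diff_right inner_commute algebra_simps)
      moreover have "u * J x + v * J y \<le> u * (d + inverse (real (Suc n))) + v * (d + inverse (real (Suc n)))"
        using xy uv by (intro add_mono mult_left_mono) (auto simp: C_def)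
      moreover have "u * (d + inverse (real (Suc n))) + v * (d + inverse (real (Suc n)))
          = d + inverse (real (Suc n))"
        by (simp add: v algebra_simps)
      moreover have "0 \<le> u * v * (norm (x - y))\<^sup>2"
        using uv by simp
      ultimately show "u *\<^sub>R x + v *\<^sub>R y \<in> C n"
        by (simp add: C_def)
    qed
    have "\<exists>r\<in>range J. r < d + inverse (real (Suc n))"
      by (rule cInf_lessD) (auto simp: d_def)
    then obtain x where x: "J x < d + inverse (real (Suc n))" by auto
    moreover have "inverse (real (Suc n)) \<le> 1"
      by (simp add: field_simps)
    ultimately have "(norm x - K)\<^sup>2 \<le> d + 1 + K\<^sup>2"
      using J_ge[of x] by linarith
    then have "norm x \<le> K + sqrt (d + 1 + K\<^sup>2)"
      using real_le_rsqrt by fastforce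
    with x show "\<exists>x\<in>C n. norm x \<le> K + sqrt (d + 1 + K\<^sup>2)"
      by (intro bexI[of _ x]) (auto simp: C_def)
  next
    show "decseq C"
    proof (rule decseq_SucI, rule subsetI)
      fix n x assume "x \<in> C (Suc n)"
      moreover have "inverse (real (Suc (Suc n))) \<le> inverse (real (Suc n))"
        by (simp add: field_simps)
      ultimately show "x \<in> C n" unfolding C_def mem_Collect_eq by linarith
    qed
  qed
  then obtain y where y: "\<And>n. J y \<le> d + inverse (real (Suc n))"
    by (auto simp: C_def)
  have "(\<lambda>n. d + inverse (real (Suc n))) \<longlonglongrightarrow> d + 0"
    by (intro tendsto_intros LIMSEQ_inverse_real_of_nat)
  then have "J y \<le> d + 0"
    by (rule LIMSEQ_le_const) (use y in blast)
  then have min: "J y \<le> J x" for x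
    using d_le[of x] by linarith
  have "f x = inner x y" for x
  proof (rule ccontr)
    define a b where "a = (norm x)\<^sup>2" and "b = inner x y - f x"
    assume "f x \<noteq> inner x y"
    then have b: "b\<^sup>2 > 0" by (simp add: b_def)
    have a: "a \<ge> 0" by (simp add: a_def)
    \<comment> \<open>\<open>J (y + t *\<^sub>R x) - J y = t\<^sup>2 * a + 2 * t * b\<close> would be negative for this \<open>t\<close>, which minimizes the
      quadratic up to the shift by one that keeps the denominator positive.\<close>
    define t where "t = - b / (a + 1)"
    have "J (y + t *\<^sub>R x) = J y + t\<^sup>2 * a + 2 * t * b"
      unfolding J_def f.add f.scaleR a_def b_def
      by (simp add: power2_norm_eq_inner inner_add_left inner_add_right inner_commute algebra_simps)
        (simp add: power2_eq_square)
    then have "0 \<le> t\<^sup>2 * a + 2 * t * b"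
      using min[of "y + t *\<^sub>R x"] by linarith
    also have "t\<^sup>2 * a + 2 * t * b = - (b\<^sup>2 * (a + 2)) / (a + 1)\<^sup>2"
    proof -
      have b_eq: "b = - t * (a + 1)" using a by (simp add: t_def)
      have "t\<^sup>2 * a + 2 * t * (- t * (a + 1)) = - (t\<^sup>2 * (a + 2))"
        by (simp add: power2_eq_square algebra_simps)
      then have "t\<^sup>2 * a + 2 * t * b = - (t\<^sup>2 * (a + 2))"
        by (simp only: flip: b_eq)
      then show ?thesis by (simp add: t_def power_divide)
    qed
    also have "\<dots> < 0"
      using a b by (simp add: divide_less_0_iff)
    finally show False by simp
  qed
  then show ?thesis by blast
qed

text \<open>A limit of images \<open>T x\<^sub>k\<close> with \<open>x\<^sub>k\<close> in the ball is again such an image, although the \<open>x\<^sub>k\<close> need not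
converge: the preimages in the ball of shrinking balls around the limit are nested, closed and
convex.\<close>

lemma closed_image_cball:
  fixes T :: "'a::{real_inner,complete_space} \<Rightarrow> 'b::real_normed_vector"
  assumes T: "bounded_linear T"
  shows "closed (T ` cball 0 r)"
proof (rule closed_sequential_limits[THEN iffD2], intro allI impI)
  interpret T: bounded_linear T by (rule T)
  fix Y y assume "(\<forall>n. Y n \<in> T ` cball 0 r) \<and> Y \<longlonglongrightarrow> y"
  then have Y: "\<And>n. Y n \<in> T ` cball 0 r" "Y \<longlonglongrightarrow> y" by auto
  define C where "C n = cball 0 r \<inter> T -` cball y (inverse (real (Suc n)))" for n
  have "\<exists>x. \<forall>n. x \<in> C n"
  proof (rule nested_closed_convex[where K = r])
    fix n
    show "closed (C n)"
      unfolding C_def by (intro closed_Int closed_vimage T.continuous_on continuous_intros) auto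
    show "convex (C n)"
      unfolding C_def by (intro convex_Int convex_linear_vimage T.linear_axioms) auto
    have "eventually (\<lambda>k. dist (Y k) y < inverse (real (Suc n))) sequentially"
      using tendstoD[OF Y(2)] by simp
    then obtain k where "dist (Y k) y < inverse (real (Suc n))"
      using eventually_happens'[OF sequentially_bot] by blast
    with Y(1)[of k] show "\<exists>x\<in>C n. norm x \<le> r"
      by (force simp: C_def dist_commute)
  next
    have "inverse (real (Suc (Suc n))) \<le> inverse (real (Suc n))" for n
      by (simp add: field_simps)
    then show "decseq C"
      by (intro decseq_SucI) (force simp: C_def intro: order_trans)
  qed
  then obtain x where x: "x \<in> cball 0 r" "\<And>n. dist y (T x) \<le> inverse (real (Suc n))"
    by (auto simp: C_def)
  have "dist y (T x) \<le> 0"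
    using LIMSEQ_inverse_real_of_nat by (rule LIMSEQ_le_const) (use x in auto)
  with x show "y \<in> T ` cball 0 r" by auto
qed

text \<open>By Baire's theorem in the complete space \<open>range T\<close>, some \<open>T ` cball 0 n\<close> has an interior point in
the range; as the images of balls are closed, it is one of the image itself and not only of its
closure.  Injectivity and the symmetry and convexity of balls move this point to the origin, so that
small vectors in the range have bounded preimages.\<close>

lemma injective_closed_range_bounded_below:
  fixes T :: "'a::{real_inner,complete_space} \<Rightarrow> 'b::{real_normed_vector,complete_space}"
  assumes T: "bounded_linear T" and inj: "\<And>x. T x = 0 \<Longrightarrow> x = 0" and closed: "closed (range T)"
  shows "\<exists>c>0. \<forall>x. c * norm x \<le> norm (T x)"
proof -
  interpret T: bounded_linear T by (rule T)
  let ?X = "top_of_set (range T)"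
  have "\<exists>n::nat. ?X interior_of (T ` cball 0 (real n)) \<noteq> {}"
  proof (rule ccontr)
    assume "\<not> ?thesis"
    then have "?X interior_of (\<Union>n::nat. T ` cball 0 (real n)) = {}"
      by (intro Baire_category_alt disjI1 completely_metrizable_space_closedin
            completely_metrizable_space_euclidean)
         (auto simp: closed closed_image_cball T intro!: closed_subset)
    moreover have "(\<Union>n::nat. T ` cball 0 (real n)) = range T"
      using real_arch_simple by fastforce
    ultimately show False
      by (metis empty_not_UNIV image_is_empty interior_of_topspace topspace_euclidean_subtopology)
  qed
  then obtain n :: nat and x0 where "T x0 \<in> ?X interior_of (T ` cball 0 (real n))"
    using interior_of_subset_topspace by fastforce
  then obtain U where U: "open U" "T x0 \<in> U" "range T \<inter> U \<subseteq> T ` cball 0 (real n)"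
    by (auto simp: interior_of_def openin_open)
  then obtain r where r: "r > 0" "ball (T x0) r \<subseteq> U"
    using openE by blast
  have inj': "x = x'" if "T x = T x'" for x x'
    using inj[of "x - x'"] that by (simp add: T.diff)
  have small: "norm x \<le> real n" if "norm (T x) < r" for x
  proof -
    have "T (x0 + x) \<in> U" "T (x0 - x) \<in> U"
      using r(2) that by (auto simp: T.add T.diff dist_norm)
    then have "T (x0 + x) \<in> T ` cball 0 (real n)" "T (x0 - x) \<in> T ` cball 0 (real n)"
      using U(3) by blast+
    then have "norm (x0 + x) \<le> n" "norm (x0 - x) \<le> n"
      by (auto dest!: inj')
    \<comment> \<open>Averaging the two translates removes the centre \<open>x0\<close>.\<close>
    moreover have "norm (2 *\<^sub>R x) \<le> norm (x0 + x) + norm (x0 - x)"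
      using norm_triangle_ineq4[of "x0 + x" "x0 - x"] by (simp add: scaleR_2)
    ultimately show ?thesis by simp
  qed
  define c where "c = r / (2 * (real n + 1))"
  have "c * norm x \<le> norm (T x)" for x
  proof (rule ccontr)
    assume "\<not> c * norm x \<le> norm (T x)"
    then have less: "norm (T x) < c * norm x" by simp
    then have nx: "norm x > 0"
      by (metis mult_zero_right norm_ge_zero norm_zero not_less zero_less_norm_iff)
    define s where "s = 2 * (real n + 1) / norm x"
    have s: "s > 0" using nx by (simp add: s_def)
    have "norm (T (s *\<^sub>R x)) = s * norm (T x)"
      using s by (simp add: T.scaleR)
    also have "\<dots> < s * (c * norm x)"
      using less s by simp
    also have "\<dots> = r"
      using nx add_pos_nonneg[of 1 "real n"] by (simp add: s_def c_def)
    finally have "norm (s *\<^sub>R x) \<le> n"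
      using small by blast
    moreover have "norm (s *\<^sub>R x) = 2 * (real n + 1)"
      using nx by (simp add: s_def)
    ultimately show False by simp
  qed
  moreover have "c > 0" using r by (simp add: c_def)
  ultimately show ?thesis by blast
qed

section \<open>Left inverses in C*-algebras of operators\<close>

lemma Im_cinner: "Im (cinner x y) = - inner (\<i> *\<^sub>C x) y"
  by (simp add: inner_eq_Re_cinner cinner_scaleC_left)

lemma cinner_eq_right: "(\<And>x. cinner x y = cinner x z) \<Longrightarrow> y = z"
  by (metis inner_eq_Re_cinner vector_eq_ldot)

lemma cinner_scaleC_right: "cinner x (c *\<^sub>C y) = cnj c * cinner x y"
  by (metis cinner_commute cinner_scaleC_left complex_cnj_mult complex_cnj_cnj)

text \<open>The Riesz representation yields an adjoint with respect to the real inner product; as \<open>T\<close> commutes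
with the multiplication by \<open>\<i>\<close>, it is also one for the complex form.\<close>

lemma cadjoint_exists:
  fixes T :: "'a::chilbert_space \<Rightarrow>\<^sub>L 'a"
  assumes T: "\<And>c x. T (c *\<^sub>C x) = c *\<^sub>C T x"
  shows "\<exists>S :: 'a \<Rightarrow>\<^sub>L 'a. \<forall>x y. cinner (T x) y = cinner x (S y)"
proof -
  have "\<exists>z. \<forall>x. inner (T x) y = inner x z" for y
    by (intro Riesz_representation bounded_linear_compose[OF bounded_linear_inner_left]
        blinfun.bounded_linear_right)
  then obtain S where S: "\<And>x y. inner (T x) y = inner x (S y)"
    by metis
  have "bounded_linear S"
  proof (rule bounded_linear_intro)
    show "S (x + y) = S x + S y" for x y
      by (rule vector_eq_ldot[THEN iffD1]) (simp add: inner_add_right flip: S)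
    show "S (r *\<^sub>R x) = r *\<^sub>R S x" for r x
      by (rule vector_eq_ldot[THEN iffD1]) (simp flip: S)
    show "norm (S y) \<le> norm y * norm T" for y
    proof (cases "S y = 0")
      case False
      have "norm (S y) * norm (S y) = inner (T (S y)) y"
        by (simp add: S flip: power2_norm_eq_inner power2_eq_square)
      also have "\<dots> \<le> norm (T (S y)) * norm y"
        by (rule norm_cauchy_schwarz)
      also have "\<dots> \<le> (norm T * norm (S y)) * norm y"
        by (intro mult_right_mono norm_blinfun) auto
      finally show ?thesis
        using False by (simp add: mult.commute mult.left_commute)
    qed simp
  qed
  then have "blinfun_apply (Blinfun S) = S"
    by (rule bounded_linear_Blinfun_apply)
  moreover have "cinner (T x) y = cinner x (S y)" for x y
    by (rule complex_eqI) (simp_all add: Im_cinner S flip: inner_eq_Re_cinner T)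
  ultimately show ?thesis by metis
qed

lemma cinner_cadjoint:
  fixes T :: "'a::chilbert_space \<Rightarrow>\<^sub>L 'a"
  assumes T: "\<And>c x. T (c *\<^sub>C x) = c *\<^sub>C T x"
  shows "cinner (T x) y = cinner x (cadjoint T y)"
proof -
  have "\<exists>!S :: 'a \<Rightarrow>\<^sub>L 'a. \<forall>x y. cinner (T x) y = cinner x (S y)"
    using cadjoint_exists[of T, OF T] by (metis blinfun_eqI cinner_eq_right)
  from theI'[OF this] show ?thesis
    unfolding cadjoint_def by blast
qed

lemma scalar_op_apply [simp]: "scalar_op c x = c *\<^sub>C x"
  by (simp add: scalar_op.rep_eq)

text \<open>This algebra contains every set of complex-linear operators, so that the hulls of such sets are
intersections of nonempty families.\<close>

lemma cstar_operator_algebra_clinear: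
  "cstar_operator_algebra {T :: 'a::chilbert_space \<Rightarrow>\<^sub>L 'a. \<forall>c x. T (c *\<^sub>C x) = c *\<^sub>C T x}"
  (is "cstar_operator_algebra ?L")
proof -
  have "cadjoint T \<in> ?L" if "T \<in> ?L" for T
  proof -
    have T: "\<And>c x. T (c *\<^sub>C x) = c *\<^sub>C T x" using that by simp
    have "cadjoint T (c *\<^sub>C y) = c *\<^sub>C cadjoint T y" for c y
      by (rule cinner_eq_right) (simp add: cinner_scaleC_right flip: cinner_cadjoint[of T, OF T])
    then show ?thesis by simp
  qed
  moreover have "closed ?L"
  proof -
    have "continuous_on UNIV (\<lambda>T :: 'a \<Rightarrow>\<^sub>L 'a. c *\<^sub>C T x)" for c x
      by (intro bounded_linear.continuous_on[OF bounded_linear_scaleC] continuous_intros)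
    then show ?thesis
      by (intro closed_Collect_all closed_Collect_eq continuous_intros)
  qed
  moreover have "c *\<^sub>C 0 = (0 :: 'a)" for c
    using norm_scaleC[of c "0 :: 'a"] by simp
  moreover have "scalar_op c o\<^sub>L T \<in> ?L" if "T \<in> ?L" for c T
    using that by (simp add: scaleC_scaleC mult.commute)
  moreover have "S + T \<in> ?L" "S o\<^sub>L T \<in> ?L" if "S \<in> ?L" "T \<in> ?L" for S T
    using that by (simp_all add: blinfun.add_left scaleC_add_right)
  ultimately show ?thesis
    unfolding cstar_operator_algebra_def by simp
qed

lemma cstar_operator_algebra_hull:
  fixes X :: "('a::chilbert_space \<Rightarrow>\<^sub>L 'a) set"
  assumes "\<And>T c x. T \<in> X \<Longrightarrow> T (c *\<^sub>C x) = c *\<^sub>C T x"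
  shows "cstar_operator_algebra (cstar_operator_algebra hull X)"
proof -
  have Inter: "cstar_operator_algebra (\<Inter>F)" if F: "F \<noteq> {}" "\<And>B. B \<in> F \<Longrightarrow> cstar_operator_algebra B" for F :: "('a \<Rightarrow>\<^sub>L 'a) set set"
  proof -
    have "closed (\<Inter>F)"
      using F by (intro closed_Inter) (auto simp: cstar_operator_algebra_def)
    moreover obtain B where "B \<in> F" using F(1) by blast
    then have "\<forall>T\<in>\<Inter>F. \<forall>c x. T (c *\<^sub>C x) = c *\<^sub>C T x"
      using F(2)[of B] unfolding cstar_operator_algebra_def by blast
    ultimately show ?thesis
      using F(2) unfolding cstar_operator_algebra_def by simp
  qed
  show ?thesis
    unfolding hull_def
  proof (rule Inter)
    have "X \<subseteq> {T :: 'a \<Rightarrow>\<^sub>L 'a. \<forall>c x. T (c *\<^sub>C x) = c *\<^sub>C T x}"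
      using assms by blast
    then show "{B. cstar_operator_algebra B \<and> X \<subseteq> B} \<noteq> {}"
      using cstar_operator_algebra_clinear by blast
  qed simp
qed

text \<open>\<open>N = T\<^sup>* T\<close> is bounded from below in the quadratic sense: \<open>inner x (N x) \<ge> c\<^sup>2 (norm x)\<^sup>2\<close>.  A
small enough positive multiple \<open>t N\<close> of it therefore differs from the identity by an operator of norm
less than one.  The Neumann series inverts \<open>t N\<close> inside the closed algebra, and \<open>(t N)\<^sup>-\<^sup>1 (t T\<^sup>*)\<close> is the
required left inverse.\<close>

lemma left_inverse_in_cstar_operator_algebra:
  fixes T :: "'a::chilbert_space \<Rightarrow>\<^sub>L 'a"
  assumes A: "cstar_operator_algebra A" and id: "id_blinfun \<in> A" and T: "T \<in> A"
    and c: "c > 0" "\<And>x. c * norm x \<le> norm (T x)"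
  shows "\<exists>S\<in>A. S o\<^sub>L T = id_blinfun"
proof -
  have A': "0 \<in> A" "\<And>V W. V \<in> A \<Longrightarrow> W \<in> A \<Longrightarrow> V + W \<in> A"
    "\<And>V W. V \<in> A \<Longrightarrow> W \<in> A \<Longrightarrow> V o\<^sub>L W \<in> A" "\<And>a V. V \<in> A \<Longrightarrow> scalar_op a o\<^sub>L V \<in> A"
    "\<And>V. V \<in> A \<Longrightarrow> cadjoint V \<in> A" "closed A" "\<And>a x. T (a *\<^sub>C x) = a *\<^sub>C T x"
    using A T unfolding cstar_operator_algebra_def by simp_all
  have adj: "cinner (T x) y = cinner x (cadjoint T y)" for x y
    by (rule cinner_cadjoint) (rule A'(7))
  define N where "N = cadjoint T o\<^sub>L T"
  have N: "N \<in> A" unfolding N_def by (intro A' T)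
  \<comment> \<open>Any bound \<open>L \<ge> norm N\<close> gives \<open>(norm (x - t *\<^sub>R N x))\<^sup>2 \<le> (1 - 2 * t * c\<^sup>2 + t\<^sup>2 * L\<^sup>2) * (norm x)\<^sup>2\<close>,
    which is smallest at \<open>t = c\<^sup>2 / L\<^sup>2\<close>.  The further summands make \<open>L\<close> positive and keep the value
    \<open>1 - c\<^sup>4 / L\<^sup>2\<close> of the factor nonnegative.\<close>
  define L where "L = norm N + 1 + c\<^sup>2"
  define t where "t = c\<^sup>2 / L\<^sup>2"
  define R where "R = id_blinfun - t *\<^sub>R N"
  have L: "L > 0" "norm N \<le> L" "c\<^sup>2 \<le> L"
    using norm_ge_zero[of N] zero_le_power2[of c] unfolding L_def by linarith+
  define q where "q = sqrt (1 - (c\<^sup>2)\<^sup>2 / L\<^sup>2)"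
  have q: "0 \<le> q" "q < 1" "q\<^sup>2 = 1 - (c\<^sup>2)\<^sup>2 / L\<^sup>2"
  proof -
    have "(c\<^sup>2)\<^sup>2 \<le> L\<^sup>2" using L by (intro power_mono) auto
    then have "0 \<le> 1 - (c\<^sup>2)\<^sup>2 / L\<^sup>2" using L by simp
    then show "0 \<le> q" "q\<^sup>2 = 1 - (c\<^sup>2)\<^sup>2 / L\<^sup>2"
      by (auto simp: q_def)
    show "q < 1" using c L by (simp add: q_def)
  qed
  have "norm (R x) \<le> q * norm x" for x
  proof (rule power2_le_imp_le)
    have "inner x (N x) = (norm (T x))\<^sup>2"
      by (simp add: N_def inner_eq_Re_cinner power2_norm_eq_inner flip: adj)
    moreover have "(norm (x - t *\<^sub>R N x))\<^sup>2 = (norm x)\<^sup>2 - 2 * t * inner x (N x) + t\<^sup>2 * (norm (N x))\<^sup>2"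
      by (simp add: power2_norm_eq_inner inner_diff_left inner_diff_right inner_commute algebra_simps)
        (simp add: power2_eq_square)
    ultimately have "(norm (R x))\<^sup>2 = (norm x)\<^sup>2 - 2 * t * (norm (T x))\<^sup>2 + t\<^sup>2 * (norm (N x))\<^sup>2"
      by (simp add: R_def blinfun.diff_left blinfun.scaleR_left)
    also have "\<dots> \<le> (norm x)\<^sup>2 - 2 * t * (c * norm x)\<^sup>2 + t\<^sup>2 * (L * norm x)\<^sup>2"
    proof -
      have "(c * norm x)\<^sup>2 \<le> (norm (T x))\<^sup>2"
        using c by (intro power_mono) auto
      moreover have "norm (N x) \<le> L * norm x"
        using norm_blinfun[of N x] L(2) by (meson mult_right_mono norm_ge_zero order_trans)
      then have "(norm (N x))\<^sup>2 \<le> (L * norm x)\<^sup>2"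
        by (intro power_mono) auto
      moreover have "t \<ge> 0" by (simp add: t_def)
      ultimately show ?thesis
        by (intro add_mono diff_mono mult_left_mono) auto
    qed
    also have "\<dots> = (q * norm x)\<^sup>2"
      unfolding power_mult_distrib q(3) using L(1) by (simp add: t_def field_simps power2_eq_square)
    finally show "(norm (R x))\<^sup>2 \<le> (q * norm x)\<^sup>2" .
    show "0 \<le> q * norm x" using q by simp
  qed
  then have R: "norm R \<le> q"
    using q by (intro norm_blinfun_bound) auto
  have smult: "r *\<^sub>R V \<in> A" if "V \<in> A" for r V
  proof -
    have "r *\<^sub>R V = scalar_op (complex_of_real r) o\<^sub>L V"
      by (rule blinfun_eqI) (simp add: scaleC_of_real blinfun.scaleR_left)
    then show ?thesis using A'(4)[OF that] by simp
  qed
  have RA: "R \<in> A"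
  proof -
    have "R = id_blinfun + (- t) *\<^sub>R N" by (simp add: R_def)
    then show ?thesis using A'(2)[OF id smult[OF N, of "- t"]] by simp
  qed
  define W where "W k = ((\<lambda>V. V o\<^sub>L R) ^^ k) id_blinfun" for k
  have W_simps: "W 0 = id_blinfun" "W (Suc k) = W k o\<^sub>L R" for k
    by (simp_all add: W_def)
  have WA: "W k \<in> A" for k
    by (induction k) (simp_all add: W_simps A'(3) id RA)
  have W_norm: "norm (W k) \<le> q ^ k" for k
  proof (induction k)
    case 0
    show ?case by (simp add: W_simps norm_blinfun_id_le)
  next
    case (Suc k)
    have "norm (W (Suc k)) \<le> norm (W k) * norm R"
      by (simp add: W_simps norm_blinfun_compose)
    also have "\<dots> \<le> q ^ k * q"
      using Suc R q by (intro mult_mono) auto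
    finally show ?case by (simp add: mult.commute)
  qed
  have "summable W"
    by (rule summable_comparison_test'[of "\<lambda>k. q ^ k"]) (use q W_norm in \<open>auto intro: summable_geometric\<close>)
  then have sums: "(\<lambda>n. \<Sum>k<n. W k) \<longlonglongrightarrow> suminf W"
    by (rule summable_LIMSEQ)
  have "(\<Sum>k<n. W k) \<in> A" for n
    by (induction n) (simp_all add: A'(1,2) WA)
  then have SA: "suminf W \<in> A"
    using closed_sequentially[OF A'(6) _ sums] by blast
  have telescope: "(\<Sum>k<n. W k) o\<^sub>L (t *\<^sub>R N) = id_blinfun - W n" for n
  proof (induction n)
    case (Suc n)
    have "W n o\<^sub>L (t *\<^sub>R N) = W n - W (Suc n)"
      by (rule blinfun_eqI) (simp add: W_simps R_def blinfun.diff_left blinfun.diff_right)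
    with Suc show ?case
      by (simp add: bounded_bilinear.add_left[OF bounded_bilinear_blinfun_compose])
  qed (simp add: W_simps bounded_bilinear.zero_left[OF bounded_bilinear_blinfun_compose])
  have "(\<lambda>n. (\<Sum>k<n. W k) o\<^sub>L (t *\<^sub>R N)) \<longlonglongrightarrow> (suminf W o\<^sub>L (t *\<^sub>R N))"
    by (intro bounded_bilinear.tendsto[OF bounded_bilinear_blinfun_compose] sums tendsto_const)
  moreover have "(\<lambda>n. id_blinfun - W n) \<longlonglongrightarrow> id_blinfun - 0"
    using \<open>summable W\<close> by (intro tendsto_intros summable_LIMSEQ_zero)
  ultimately have "suminf W o\<^sub>L (t *\<^sub>R N) = id_blinfun"
    unfolding telescope by (metis LIMSEQ_unique diff_zero)
  moreover have "(suminf W o\<^sub>L (t *\<^sub>R cadjoint T)) o\<^sub>L T = suminf W o\<^sub>L (t *\<^sub>R N)"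
    by (rule blinfun_eqI) (simp add: N_def blinfun.scaleR_left)
  moreover have "suminf W o\<^sub>L (t *\<^sub>R cadjoint T) \<in> A"
    by (intro A' smult SA T)
  ultimately show ?thesis by metis
qed

section \<open>Holomorphic functions of several variables\<close>

lemma norm_vector_smult: "norm (c *s x) = norm c * norm (x :: complex^'m)"
  by (simp add: norm_vec_def norm_mult L2_set_right_distrib)

lemma bounded_bilinear_vector_smult:
  "bounded_bilinear (\<lambda>c (x :: complex^'m). c *s x)"
proof (rule bounded_bilinear.intro)
  show "(a + a') *s b = a *s b + a' *s b" for a a' and b :: "complex^'m"
    by (rule vector_sadd_rdistrib)
  show "a *s (b + b') = a *s b + a *s b'" for a and b b' :: "complex^'m"
    by (rule vector_add_ldistrib)
  show "(r *\<^sub>R a) *s b = r *\<^sub>R (a *s b)" for r a and b :: "complex^'m"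
    by (simp add: vec_eq_iff)
  show "a *s (r *\<^sub>R b) = r *\<^sub>R (a *s b)" for r a and b :: "complex^'m"
    by (simp add: vec_eq_iff)
  show "\<exists>K. \<forall>a (b :: complex^'m). norm (a *s b) \<le> norm a * norm b * K"
    by (rule exI[of _ 1]) (simp add: norm_vector_smult)
qed

lemmas tendsto_vector_smult [tendsto_intros] =
  bounded_bilinear.tendsto[OF bounded_bilinear_vector_smult]
lemmas continuous_on_vector_smult [continuous_intros] =
  bounded_bilinear.continuous_on[OF bounded_bilinear_vector_smult]

lemma holomorphic_several_const: "holomorphic_several (\<lambda>z. c) U"
  unfolding holomorphic_several_def
  by (intro ballI exI[of _ "\<lambda>v. 0"]) (auto intro: derivative_intros)

lemma holomorphic_several_add:
  assumes "holomorphic_several f U" "holomorphic_several g U"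
  shows "holomorphic_several (\<lambda>z. f z + g z) U"
  unfolding holomorphic_several_def
proof
  fix z assume "z \<in> U"
  then obtain D E where "(f has_derivative D) (at z)" "\<And>c v. D (c *s v) = c * D v"
    "(g has_derivative E) (at z)" "\<And>c v. E (c *s v) = c * E v"
    using assms unfolding holomorphic_several_def by metis
  then show "\<exists>D. ((\<lambda>z. f z + g z) has_derivative D) (at z) \<and> (\<forall>c v. D (c *s v) = c * D v)"
    by (intro exI[of _ "\<lambda>v. D v + E v"]) (auto intro: derivative_intros simp: algebra_simps)
qed

lemma holomorphic_several_mult:
  assumes "holomorphic_several f U" "holomorphic_several g U"
  shows "holomorphic_several (\<lambda>z. f z * g z) U"
  unfolding holomorphic_several_def
proof
  fix z assume "z \<in> U"
  then obtain D E where "(f has_derivative D) (at z)" "\<And>c v. D (c *s v) = c * D v"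
    "(g has_derivative E) (at z)" "\<And>c v. E (c *s v) = c * E v"
    using assms unfolding holomorphic_several_def by metis
  then show "\<exists>D. ((\<lambda>z. f z * g z) has_derivative D) (at z) \<and> (\<forall>c v. D (c *s v) = c * D v)"
    by (intro exI[of _ "\<lambda>v. f z * E v + D v * g z"] conjI has_derivative_mult)
      (simp_all add: algebra_simps)
qed

lemma holomorphic_several_mono:
  "holomorphic_several f U \<Longrightarrow> V \<subseteq> U \<Longrightarrow> holomorphic_several f V"
  unfolding holomorphic_several_def by blast

lemma holomorphic_several_cong:
  assumes "holomorphic_several f U" "open U" "\<And>z. z \<in> U \<Longrightarrow> f z = g z"
  shows "holomorphic_several g U"
  unfolding holomorphic_several_def
proof
  fix z assume z: "z \<in> U"
  then obtain D where D: "(f has_derivative D) (at z)" "\<forall>c v. D (c *s v) = c * D v"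
    using assms(1) unfolding holomorphic_several_def by blast
  have "(g has_derivative D) (at z)"
    by (rule has_derivative_transform_within_open[OF D(1) assms(2) z assms(3)])
  with D(2) show "\<exists>D. (g has_derivative D) (at z) \<and> (\<forall>c v. D (c *s v) = c * D v)"
    by blast
qed

lemma holomorphic_several_imp_continuous_on:
  assumes "holomorphic_several f U"
  shows "continuous_on U f"
proof (rule continuous_at_imp_continuous_on, rule ballI)
  fix z assume "z \<in> U"
  then obtain D where "(f has_derivative D) (at z)"
    using assms unfolding holomorphic_several_def by blast
  then show "isCont f z"
    by (rule has_derivative_continuous)
qed

lemma holomorphic_several_on_complex_line:
  fixes w v :: "complex^'n"
  assumes f: "holomorphic_several f U"
  shows "(\<lambda>t. f (w + t *s v)) holomorphic_on {t. w + t *s v \<in> U}"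
  unfolding holomorphic_on_def
proof
  fix t assume "t \<in> {t. w + t *s v \<in> U}"
  then obtain D where D: "(f has_derivative D) (at (w + t *s v))" "\<And>c u. D (c *s u) = c * D u"
    using f unfolding holomorphic_several_def by blast
  have "((\<lambda>s. w + s *s v) has_derivative (\<lambda>s. s *s v)) (at t)"
    by (rule derivative_eq_intros bounded_linear_imp_has_derivative
        bounded_bilinear.bounded_linear_left[OF bounded_bilinear_vector_smult] | simp)+
  then have "((\<lambda>s. f (w + s *s v)) has_derivative (\<lambda>s. D (s *s v))) (at t)"
    using D(1) by (rule has_derivative_compose)
  moreover have "(\<lambda>s. D (s *s v)) = (*) (D v)"
    by (rule ext) (simp add: D(2))
  ultimately have "((\<lambda>s. f (w + s *s v)) has_field_derivative D v) (at t)"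
    by (simp add: has_field_derivative_def)
  then show "(\<lambda>t. f (w + t *s v)) field_differentiable at t within {t. w + t *s v \<in> U}"
    using field_differentiable_def field_differentiable_at_within by blast
qed

text \<open>Any point of the ball is joined by a complex line to a point near which \<open>f\<close> vanishes.  The line meets
the ball in a convex set, on which the identity theorem of one variable applies.\<close>

lemma holomorphic_several_zero_on_ball:
  fixes f :: "complex^'n \<Rightarrow> complex"
  assumes f: "holomorphic_several f (ball z r)" and w: "w \<in> ball z r"
    and e: "e > 0" "\<And>u. u \<in> ball w e \<Longrightarrow> f u = 0" and u: "u \<in> ball z r"
  shows "f u = 0"
proof -
  define l where "l t = w + t *s (u - w)" for t
  have cont: "continuous_on UNIV l"
    unfolding l_def by (intro continuous_intros)
  have "convex (l -` ball z r)"
  proof (rule convexI)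
    fix s t and a b :: real
    assume st: "s \<in> l -` ball z r" "t \<in> l -` ball z r" and ab: "0 \<le> a" "0 \<le> b" "a + b = 1"
    have "l (a *\<^sub>R s + b *\<^sub>R t) = a *\<^sub>R l s + b *\<^sub>R l t"
    proof -
      have b: "b = 1 - a" using ab by simp
      show ?thesis unfolding b l_def by (simp add: vec_eq_iff scaleR_conv_of_real[where 'a = complex] algebra_simps)
    qed
    then show "a *\<^sub>R s + b *\<^sub>R t \<in> l -` ball z r"
      using convexD[OF convex_ball, of "l s" z r "l t" a b] st ab by simp
  qed
  have "f (l 1) = 0"
  proof (rule analytic_continuation_open[where f = "\<lambda>t. f (l t)" and g = "\<lambda>t. 0"
        and s = "l -` ball w e \<inter> l -` ball z r" and s' = "l -` ball z r"])
    show "open (l -` ball w e \<inter> l -` ball z r)" "open (l -` ball z r)"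
      using cont by (auto intro!: open_Int open_vimage)
    have "0 \<in> l -` ball w e \<inter> l -` ball z r"
      using e w by (simp add: l_def)
    then show "l -` ball w e \<inter> l -` ball z r \<noteq> {}" by blast
    show "connected (l -` ball z r)"
      by (rule convex_connected) fact
    show "(\<lambda>t. f (l t)) holomorphic_on l -` ball z r"
      using holomorphic_several_on_complex_line[OF f, of w "u - w"]
      unfolding l_def vimage_def .
    show "1 \<in> l -` ball z r"
      using u by (simp add: l_def)
  qed (use e in auto)
  then show ?thesis by (simp add: l_def)
qed

text \<open>The set \<open>W\<close> of points near which \<open>f\<close> vanishes is open; so is its complement, because a ball in the
domain that meets \<open>W\<close> consists of zeros.\<close>

lemma identity_theorem_several:
  fixes f :: "complex^'n \<Rightarrow> complex"
  assumes f: "holomorphic_several f \<Omega>" and \<Omega>: "open \<Omega>" "connected \<Omega>"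
    and z: "z \<in> \<Omega>" and e: "e > 0" "\<And>u. u \<in> ball z e \<Longrightarrow> f u = 0" and w: "w \<in> \<Omega>"
  shows "f w = 0"
proof -
  define W where "W = {u \<in> \<Omega>. \<exists>e>0. \<forall>v\<in>ball u e. f v = 0}"
  have spread: "\<forall>v\<in>ball u r. f v = 0" if sp: "u' \<in> W" "u' \<in> ball u r" "ball u r \<subseteq> \<Omega>" for u u' r
  proof -
    obtain d where d: "d > 0" "\<forall>v\<in>ball u' d. f v = 0"
      using sp(1) unfolding W_def by blast
    show ?thesis
    proof
      fix v assume v: "v \<in> ball u r"
      show "f v = 0"
        using d(2)
        by (intro holomorphic_several_zero_on_ball[OF holomorphic_several_mono[OF f sp(3)] sp(2) d(1) _ v]) blast
    qed
  qed
  have "open W"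
  proof (rule Topological_Spaces.openI)
    fix u assume u: "u \<in> W"
    then obtain r where r: "r > 0" "ball u r \<subseteq> \<Omega>"
      using \<Omega>(1) openE unfolding W_def by blast
    have zero: "\<forall>v\<in>ball u r. f v = 0"
      using spread[OF u _ r(2)] r(1) by simp
    have "ball u r \<subseteq> W"
    proof
      fix v assume v: "v \<in> ball u r"
      then obtain e where "e > 0" "ball v e \<subseteq> ball u r"
        using openE[OF open_ball] by blast
      then show "v \<in> W"
        using zero v r(2) unfolding W_def by blast
    qed
    with r show "\<exists>T. open T \<and> u \<in> T \<and> T \<subseteq> W"
      by (intro exI[of _ "ball u r"]) auto
  qed
  moreover have "open (\<Omega> - W)"
  proof (rule Topological_Spaces.openI)
    fix u assume u: "u \<in> \<Omega> - W"
    then obtain r where r: "r > 0" "ball u r \<subseteq> \<Omega>"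
      using \<Omega>(1) openE by blast
    have "u' \<notin> W" if "u' \<in> ball u r" for u'
      using spread[OF _ that r(2)] u r(1) unfolding W_def by blast
    with r show "\<exists>T. open T \<and> u \<in> T \<and> T \<subseteq> \<Omega> - W"
      by (intro exI[of _ "ball u r"]) auto
  qed
  ultimately have "W \<inter> \<Omega> = {} \<or> (\<Omega> - W) \<inter> \<Omega> = {}"
    using connectedD[OF \<Omega>(2), of W "\<Omega> - W"] by blast
  moreover have "z \<in> W"
    using z e unfolding W_def by blast
  ultimately have "w \<in> W"
    using z w by blast
  then show ?thesis
    unfolding W_def using centre_in_ball by blast
qed

section \<open>The algebras of the domain\<close>

lemma A_algE:
  assumes "f \<in> A_alg \<Omega>" "e > 0"
  obtains U g where "open U" "closure \<Omega> \<subseteq> U" "holomorphic_several g U"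
    "\<And>z. z \<in> closure \<Omega> \<Longrightarrow> norm (f z - g z) < e"
proof -
  have "\<exists>U g. open U \<and> closure \<Omega> \<subseteq> U \<and> holomorphic_several g U \<and>
      (\<forall>z\<in>closure \<Omega>. norm (f z - g z) < e)"
    using assms by (simp add: A_alg_def)
  then show thesis
    by (elim exE conjE) (rule that, auto)
qed

lemma A_alg_continuous_on:
  assumes "f \<in> A_alg \<Omega>"
  shows "continuous_on (closure \<Omega>) f"
proof -
  have "\<exists>g. continuous_on (closure \<Omega>) g \<and> (\<forall>z\<in>closure \<Omega>. norm (f z - g z) < e)" if "e > 0" for e
  proof -
    obtain U g where "closure \<Omega> \<subseteq> U" "holomorphic_several g U"
      "\<And>z. z \<in> closure \<Omega> \<Longrightarrow> norm (f z - g z) < e"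
      using A_algE[OF assms \<open>e > 0\<close>] by metis
    then show ?thesis
      using continuous_on_subset[OF holomorphic_several_imp_continuous_on] by (intro exI[of _ g]) simp
  qed
  then have "\<exists>g. continuous_on (closure \<Omega>) g \<and>
      (\<forall>z\<in>closure \<Omega>. norm (f z - g z) < inverse (real (Suc n)))" for n
    by simp
  then obtain g where g: "\<And>n. continuous_on (closure \<Omega>) (g n)"
    "\<And>n. \<forall>z\<in>closure \<Omega>. norm (f z - g n z) < inverse (real (Suc n))"
    by metis
  show ?thesis
  proof (rule uniform_limit_theorem)
    show "uniform_limit (closure \<Omega>) g f sequentially"
    proof (rule uniform_limitI)
      fix e :: real assume "e > 0"
      then have "\<forall>\<^sub>F n in sequentially. inverse (real (Suc n)) < e"
        using LIMSEQ_inverse_real_of_nat by (simp add: order_tendstoD(2))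
      then show "\<forall>\<^sub>F n in sequentially. \<forall>z\<in>closure \<Omega>. dist (g n z) (f z) < e"
      proof eventually_elim
        case (elim n)
        then show ?case using g(2)[of n] by (force simp: dist_norm norm_minus_commute)
      qed
    qed
  qed (use g in auto)
qed

lemma A_alg_bounded:
  assumes "f \<in> A_alg \<Omega>" "bounded \<Omega>"
  shows "\<exists>K>0. \<forall>z\<in>closure \<Omega>. norm (f z) \<le> K"
proof -
  have "compact (f ` closure \<Omega>)"
    using assms by (intro compact_continuous_image A_alg_continuous_on) (auto simp: compact_closure)
  then have "bounded (f ` closure \<Omega>)"
    by (rule compact_imp_bounded)
  then show ?thesis
    unfolding bounded_pos by auto
qed

lemma A_alg_mult:
  assumes f: "f \<in> A_alg \<Omega>" and g: "g \<in> A_alg \<Omega>" and \<Omega>: "bounded \<Omega>"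
  shows "(\<lambda>z. f z * g z) \<in> A_alg \<Omega>"
proof -
  obtain K where K: "K > 0" "\<And>z. z \<in> closure \<Omega> \<Longrightarrow> norm (f z) \<le> K"
    using A_alg_bounded[OF f \<Omega>] by blast
  obtain L where L: "L > 0" "\<And>z. z \<in> closure \<Omega> \<Longrightarrow> norm (g z) \<le> L"
    using A_alg_bounded[OF g \<Omega>] by blast
  have "\<exists>U h. open U \<and> closure \<Omega> \<subseteq> U \<and> holomorphic_several h U \<and>
      (\<forall>z\<in>closure \<Omega>. norm (f z * g z - h z) < e)" if e: "e > 0" for e
  proof -
    define d where "d = min 1 (e / (K + L + 1))"
    have d: "d > 0" "d \<le> 1" "d * (K + L + 1) \<le> e"
    proof -
      have KL: "K + L + 1 > 0" using K L by linarith
      then show "d > 0" "d \<le> 1" using e by (auto simp: d_def)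
      have "d \<le> e / (K + L + 1)" by (simp add: d_def)
      then show "d * (K + L + 1) \<le> e" using KL by (simp add: pos_le_divide_eq)
    qed
    obtain U f' where U: "open U" "closure \<Omega> \<subseteq> U" "holomorphic_several f' U"
        "\<And>z. z \<in> closure \<Omega> \<Longrightarrow> norm (f z - f' z) < d"
      using A_algE[OF f d(1)] by metis
    obtain V g' where V: "open V" "closure \<Omega> \<subseteq> V" "holomorphic_several g' V"
        "\<And>z. z \<in> closure \<Omega> \<Longrightarrow> norm (g z - g' z) < d"
      using A_algE[OF g d(1)] by metis
    have "norm (f z * g z - f' z * g' z) < e" if z: "z \<in> closure \<Omega>" for z
    proof -
      have "norm (g' z) \<le> L + d"
        using L(2)[OF z] V(4)[OF z] norm_triangle_ineq4[of "g z" "g z - g' z"] by simp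
      then have "norm (g' z) \<le> L + 1" using d by simp
      have "f z * g z - f' z * g' z = f z * (g z - g' z) + (f z - f' z) * g' z"
        by (simp add: algebra_simps)
      then have "norm (f z * g z - f' z * g' z) \<le> norm (f z) * norm (g z - g' z) + norm (f z - f' z) * norm (g' z)"
        by (metis norm_mult norm_triangle_ineq)
      also have "\<dots> \<le> K * norm (g z - g' z) + norm (f z - f' z) * (L + 1)"
        using K(2)[OF z] \<open>norm (g' z) \<le> L + 1\<close> by (intro add_mono mult_mono) (use K in auto)
      also have "\<dots> < K * d + d * (L + 1)"
        using U(4)[OF z] V(4)[OF z] K L by (intro add_strict_mono mult_strict_left_mono mult_strict_right_mono) auto
      also have "\<dots> \<le> e"
        using d(3) by (simp add: algebra_simps)
      finally show ?thesis .
    qed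
    moreover have "holomorphic_several (\<lambda>z. f' z * g' z) (U \<inter> V)"
      using U(3) V(3) by (intro holomorphic_several_mult) (auto elim: holomorphic_several_mono)
    ultimately show ?thesis
      using U(1,2) V(1,2) by (intro exI[of _ "U \<inter> V"] exI[of _ "\<lambda>z. f' z * g' z"]) auto
  qed
  moreover have "\<forall>z. z \<notin> closure \<Omega> \<longrightarrow> f z * g z = 0"
    using f by (simp add: A_alg_def)
  ultimately show ?thesis
    unfolding A_alg_def by simp
qed

lemma A_tensorE:
  assumes "F \<in> A_tensor \<Omega>"
  obtains k :: nat and \<theta> x where "\<And>i. i < k \<Longrightarrow> \<theta> i \<in> A_alg \<Omega>" "F = (\<lambda>z. \<Sum>i<k. \<theta> i z *s x i)"
proof -
  have "\<exists>(k::nat) \<theta> x. (\<forall>i<k. \<theta> i \<in> A_alg \<Omega>) \<and> F = (\<lambda>z. \<Sum>i<k. \<theta> i z *s x i)"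
    using assms by (simp add: A_tensor_def)
  then show thesis
    by (elim exE conjE) (rule that, auto)
qed

lemma A_tensorI:
  fixes k :: nat
  assumes "\<And>i. i < k \<Longrightarrow> \<theta> i \<in> A_alg \<Omega>" "\<And>z. F z = (\<Sum>i<k. \<theta> i z *s x i)"
  shows "F \<in> A_tensor \<Omega>"
  unfolding A_tensor_def using assms
  by (intro CollectI exI[of _ k] exI[of _ \<theta>] exI[of _ x]) auto

lemma A_tensor_scale:
  assumes "F \<in> A_tensor \<Omega>"
  shows "(\<lambda>z. c *s F z) \<in> A_tensor \<Omega>"
proof -
  obtain k :: nat and \<theta> x where F: "\<And>i. i < k \<Longrightarrow> \<theta> i \<in> A_alg \<Omega>" "F = (\<lambda>z. \<Sum>i<k. \<theta> i z *s x i)"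
    using A_tensorE[OF assms] by metis
  have "(\<lambda>z. c *s F z) = (\<lambda>z. \<Sum>i<k. \<theta> i z *s (c *s x i))"
    by (simp add: F(2) vec.scale_sum_right vector_smult_assoc mult.commute)
  with F(1) show ?thesis
    by (intro A_tensorI[where k = k and \<theta> = \<theta> and x = "\<lambda>i. c *s x i"]) (simp_all add: fun_eq_iff)
qed

lemma A_tensor_add:
  assumes "F \<in> A_tensor \<Omega>" "G \<in> A_tensor \<Omega>"
  shows "(\<lambda>z. F z + G z) \<in> A_tensor \<Omega>"
proof -
  obtain k :: nat and \<theta> x where F: "\<And>i. i < k \<Longrightarrow> \<theta> i \<in> A_alg \<Omega>" "F = (\<lambda>z. \<Sum>i<k. \<theta> i z *s x i)"
    using A_tensorE[OF assms(1)] by metis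
  obtain l :: nat and \<eta> y where G: "\<And>i. i < l \<Longrightarrow> \<eta> i \<in> A_alg \<Omega>" "G = (\<lambda>z. \<Sum>i<l. \<eta> i z *s y i)"
    using A_tensorE[OF assms(2)] by metis
  define \<zeta> where "\<zeta> i = (if i < k then \<theta> i else \<eta> (i - k))" for i
  define u where "u i = (if i < k then x i else y (i - k))" for i
  have "(\<Sum>i<k + l. \<zeta> i z *s u i) = F z + G z" for z
  proof -
    have "(\<Sum>i<k + l. \<zeta> i z *s u i) = (\<Sum>i<k. \<zeta> i z *s u i) + (\<Sum>i<l. \<zeta> (k + i) z *s u (k + i))"
      by (induction l) (simp_all add: add.assoc)
    then show ?thesis
      by (simp add: F(2) G(2) \<zeta>_def u_def)
  qed
  moreover have "\<forall>i<k + l. \<zeta> i \<in> A_alg \<Omega>"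
    using F(1) G(1) by (auto simp: \<zeta>_def)
  ultimately show ?thesis
    by (intro A_tensorI[where k = "k + l" and \<theta> = \<zeta> and x = u]) auto
qed

lemma A_tensor_diff:
  assumes "F \<in> A_tensor \<Omega>" "G \<in> A_tensor \<Omega>"
  shows "(\<lambda>z. F z - G z) \<in> A_tensor \<Omega>"
  using A_tensor_add[OF assms(1) A_tensor_scale[OF assms(2), of "-1"]]
  by (simp add: vector_smult_lneg)

lemma A_tensor_A_alg_mult:
  assumes \<phi>: "\<phi> \<in> A_alg \<Omega>" and F: "F \<in> A_tensor \<Omega>" and \<Omega>: "bounded \<Omega>"
  shows "(\<lambda>z. \<phi> z *s F z) \<in> A_tensor \<Omega>"
proof -
  obtain k :: nat and \<theta> x where F: "\<And>i. i < k \<Longrightarrow> \<theta> i \<in> A_alg \<Omega>" "F = (\<lambda>z. \<Sum>i<k. \<theta> i z *s x i)"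
    using A_tensorE[OF F] by metis
  have "(\<lambda>z. \<phi> z *s F z) = (\<lambda>z. \<Sum>i<k. (\<phi> z * \<theta> i z) *s x i)"
    by (simp add: F(2) vec.scale_sum_right vector_smult_assoc)
  then show ?thesis
    using F(1) A_alg_mult[OF \<phi> _ \<Omega>]
    by (intro A_tensorI[where k = k and \<theta> = "\<lambda>i z. \<phi> z * \<theta> i z" and x = x]) (simp_all add: fun_eq_iff)
qed

lemma A_tensor_continuous_on:
  assumes "F \<in> A_tensor \<Omega>"
  shows "continuous_on \<Omega> F"
proof -
  obtain k :: nat and \<theta> x where F: "\<And>i. i < k \<Longrightarrow> \<theta> i \<in> A_alg \<Omega>" "F = (\<lambda>z. \<Sum>i<k. \<theta> i z *s x i)"
    using A_tensorE[OF assms] by metis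
  have "continuous_on \<Omega> (\<theta> i)" if "i < k" for i
    using A_alg_continuous_on[OF F(1)[OF that]] closure_subset continuous_on_subset by blast
  then show ?thesis
    unfolding F(2) by (intro continuous_on_sum continuous_on_vector_smult continuous_on_const) auto
qed

lemma H_inf_one:
  assumes "open \<Omega>"
  shows "(\<lambda>z. if z \<in> \<Omega> then 1 else 0) \<in> H_inf \<Omega>"
proof -
  have "bounded ((\<lambda>z. if z \<in> \<Omega> then 1 else 0 :: complex) ` \<Omega>)"
    by (rule boundedI[where B = 1]) auto
  moreover have "holomorphic_several (\<lambda>z. if z \<in> \<Omega> then 1 else 0) \<Omega>"
    by (rule holomorphic_several_cong[OF holomorphic_several_const assms]) simp
  ultimately show ?thesis by (simp add: H_inf_def)
qed

lemma H_inf_add: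
  assumes "f \<in> H_inf \<Omega>" "g \<in> H_inf \<Omega>"
  shows "(\<lambda>z. f z + g z) \<in> H_inf \<Omega>"
  using assms by (simp add: H_inf_def holomorphic_several_add bounded_plus_comp)

lemma H_inf_mult:
  assumes "f \<in> H_inf \<Omega>" "g \<in> H_inf \<Omega>"
  shows "(\<lambda>z. f z * g z) \<in> H_inf \<Omega>"
proof -
  obtain K L where "\<forall>z\<in>\<Omega>. norm (f z) \<le> K" "\<forall>z\<in>\<Omega>. norm (g z) \<le> L"
    using assms by (auto simp: H_inf_def bounded_iff)
  then have "norm (f z * g z) \<le> K * L" if "z \<in> \<Omega>" for z
  proof -
    have "norm (f z) \<le> K" "norm (g z) \<le> L"
      using that \<open>\<forall>z\<in>\<Omega>. norm (f z) \<le> K\<close> \<open>\<forall>z\<in>\<Omega>. norm (g z) \<le> L\<close> by auto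
    then show ?thesis
      using order_trans[OF norm_ge_zero \<open>norm (f z) \<le> K\<close>] by (simp add: norm_mult mult_mono)
  qed
  then have "bounded ((\<lambda>z. f z * g z) ` \<Omega>)"
    by (intro boundedI[where B = "K * L"]) auto
  with assms show ?thesis by (simp add: H_inf_def holomorphic_several_mult)
qed

lemma H_inf_scale:
  assumes "f \<in> H_inf \<Omega>"
  shows "(\<lambda>z. c * f z) \<in> H_inf \<Omega>"
proof -
  obtain K where "\<forall>z\<in>\<Omega>. norm (f z) \<le> K"
    using assms by (auto simp: H_inf_def bounded_iff)
  then have "\<forall>z\<in>\<Omega>. norm (c * f z) \<le> norm c * K"
    by (simp add: norm_mult mult_left_mono)
  then have "bounded ((\<lambda>z. c * f z) ` \<Omega>)"
    by (intro boundedI[where B = "norm c * K"]) auto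
  with assms show ?thesis
    by (simp add: H_inf_def holomorphic_several_mult holomorphic_several_const)
qed

section \<open>Elements of the module as functions\<close>

locale quasi_free =
  fixes \<Omega> :: "(complex^'n) set"
    and ip :: "(complex^'n \<Rightarrow> complex^'m) \<Rightarrow> (complex^'n \<Rightarrow> complex^'m) \<Rightarrow> complex"
    and \<iota> :: "(complex^'n \<Rightarrow> complex^'m) \<Rightarrow> 'r::chilbert_space"
  assumes domain: "bounded_domain \<Omega>" and module: "quasi_free_module \<Omega> ip \<iota>"
begin

abbreviation ev :: "complex^'n \<Rightarrow> 'r \<Rightarrow> complex^'m"
  where "ev \<equiv> module_eval \<Omega> \<iota>"

lemma domain_simps: "open \<Omega>" "connected \<Omega>" "bounded \<Omega>"
  using domain by (auto simp: bounded_domain_def)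

lemma iota_add: "F \<in> A_tensor \<Omega> \<Longrightarrow> G \<in> A_tensor \<Omega> \<Longrightarrow> \<iota> (\<lambda>z. F z + G z) = \<iota> F + \<iota> G"
  and iota_scale: "F \<in> A_tensor \<Omega> \<Longrightarrow> \<iota> (\<lambda>z. c *s F z) = c *\<^sub>C \<iota> F"
  and iota_cinner: "F \<in> A_tensor \<Omega> \<Longrightarrow> G \<in> A_tensor \<Omega> \<Longrightarrow> cinner (\<iota> F) (\<iota> G) = ip F G"
  and iota_dense: "closure (\<iota> ` A_tensor \<Omega>) = UNIV"
  using module unfolding quasi_free_module_def is_completion_def by simp_all

lemmas module_conditions = module[unfolded quasi_free_module_def, THEN conjunct2, THEN conjunct2]
lemmas eval_bounded = module_conditions[THEN conjunct1]
lemmas eval_locally_bounded = module_conditions[THEN conjunct2, THEN conjunct1]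
lemmas mult_contractive = module_conditions[THEN conjunct2, THEN conjunct2, THEN conjunct1]
lemmas Cauchy_null_iff = module_conditions[THEN conjunct2, THEN conjunct2, THEN conjunct2]

lemma norm_iota: "F \<in> A_tensor \<Omega> \<Longrightarrow> norm (\<iota> F) = ip_norm ip F"
  by (simp add: norm_eq_sqrt_inner inner_eq_Re_cinner iota_cinner ip_norm_def)

lemma iota_diff:
  assumes "F \<in> A_tensor \<Omega>" "G \<in> A_tensor \<Omega>"
  shows "\<iota> (\<lambda>z. F z - G z) = \<iota> F - \<iota> G"
proof -
  have "\<iota> F = \<iota> (\<lambda>z. F z - G z) + \<iota> G"
    using iota_add[OF A_tensor_diff[OF assms] assms(2)] by simp
  then show ?thesis by simp
qed

lemma iota_approx:
  obtains F where "\<And>i. F i \<in> A_tensor \<Omega>" "(\<lambda>i. \<iota> (F i)) \<longlonglongrightarrow> f"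
proof -
  have "f \<in> closure (\<iota> ` A_tensor \<Omega>)"
    using iota_dense by simp
  then obtain y where y: "\<And>i. y i \<in> \<iota> ` A_tensor \<Omega>" "y \<longlonglongrightarrow> f"
    unfolding closure_sequential by blast
  then have "\<forall>i. \<exists>F. F \<in> A_tensor \<Omega> \<and> y i = \<iota> F" by blast
  then obtain F where "\<And>i. F i \<in> A_tensor \<Omega>" "y = (\<lambda>i. \<iota> (F i))"
    by metis
  with y(2) show thesis by (intro that[of F]) auto
qed

text \<open>Identities and estimates between continuous expressions need only be checked on the dense image of
the algebraic tensor product.\<close>

lemma dense_induct:
  assumes "closed {f. P f}" "\<And>F. F \<in> A_tensor \<Omega> \<Longrightarrow> P (\<iota> F)"
  shows "P f"
proof -
  have "closure (\<iota> ` A_tensor \<Omega>) \<subseteq> {f. P f}"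
    using assms by (intro closure_minimal) auto
  then show ?thesis using iota_dense by auto
qed

text \<open>The same extension by continuity produces the evaluations (with values in the finite-dimensional
space) and the multiplication operators (with values in the module).  The extension
is a limit along sequences; the bound makes these limits exist and independent of the sequence.\<close>

lemma extend_from_A_tensor:
  fixes g :: "(complex^'n \<Rightarrow> complex^'m) \<Rightarrow> 'b::banach"
  assumes add: "\<And>F G. F \<in> A_tensor \<Omega> \<Longrightarrow> G \<in> A_tensor \<Omega> \<Longrightarrow> g (\<lambda>z. F z + G z) = g F + g G"
    and scale: "\<And>r F. F \<in> A_tensor \<Omega> \<Longrightarrow> g (\<lambda>z. complex_of_real r *s F z) = r *\<^sub>R g F"
    and bound: "\<And>F. F \<in> A_tensor \<Omega> \<Longrightarrow> norm (g F) \<le> K * norm (\<iota> F)"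
  obtains T where "bounded_linear T" "\<And>F. F \<in> A_tensor \<Omega> \<Longrightarrow> T (\<iota> F) = g F"
    "\<And>f. norm (T f) \<le> K * norm f"
proof -
  have diff: "norm (g F - g G) \<le> K * norm (\<iota> F - \<iota> G)" if "F \<in> A_tensor \<Omega>" "G \<in> A_tensor \<Omega>" for F G
  proof -
    have "g F = g (\<lambda>z. F z - G z) + g G"
      using add[OF A_tensor_diff[OF that] that(2)] by simp
    then show ?thesis
      using bound[OF A_tensor_diff[OF that]] iota_diff[OF that] by simp
  qed
  have "\<exists>l. \<forall>G. (\<forall>i. G i \<in> A_tensor \<Omega>) \<longrightarrow> (\<lambda>i. \<iota> (G i)) \<longlonglongrightarrow> f \<longrightarrow> (\<lambda>i. g (G i)) \<longlonglongrightarrow> l" for f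
  proof -
    obtain F where F: "\<And>i. F i \<in> A_tensor \<Omega>" "(\<lambda>i. \<iota> (F i)) \<longlonglongrightarrow> f"
      using iota_approx by blast
    have "Cauchy (\<lambda>i. g (F i))"
    proof (rule metric_CauchyI)
      fix e :: real assume e: "e > 0"
      define d where "d = e / (\<bar>K\<bar> + 1)"
      have "d > 0" using e by (simp add: d_def add_nonneg_pos)
      then obtain M where M: "\<And>m n. m \<ge> M \<Longrightarrow> n \<ge> M \<Longrightarrow> dist (\<iota> (F m)) (\<iota> (F n)) < d"
        using metric_CauchyD[OF LIMSEQ_imp_Cauchy[OF F(2)]] by blast
      have "dist (g (F m)) (g (F n)) < e" if "m \<ge> M" "n \<ge> M" for m n
      proof -
        have "dist (g (F m)) (g (F n)) \<le> K * dist (\<iota> (F m)) (\<iota> (F n))"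
          using diff[OF F(1) F(1)] by (simp add: dist_norm)
        also have "\<dots> \<le> (\<bar>K\<bar> + 1) * dist (\<iota> (F m)) (\<iota> (F n))"
          by (intro mult_right_mono) auto
        also have "\<dots> < (\<bar>K\<bar> + 1) * d"
          using M[OF that] by (intro mult_strict_left_mono) auto
        also have "\<dots> = e" by (simp add: d_def)
        finally show ?thesis .
      qed
      then show "\<exists>M. \<forall>m\<ge>M. \<forall>n\<ge>M. dist (g (F m)) (g (F n)) < e" by blast
    qed
    then obtain l where l: "(\<lambda>i. g (F i)) \<longlonglongrightarrow> l"
      using Cauchy_convergent convergent_def by blast
    have "(\<lambda>i. g (G i)) \<longlonglongrightarrow> l" if G: "\<And>i. G i \<in> A_tensor \<Omega>" "(\<lambda>i. \<iota> (G i)) \<longlonglongrightarrow> f" for G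
    proof -
      have "(\<lambda>i. K * norm (\<iota> (G i) - \<iota> (F i))) \<longlonglongrightarrow> K * norm (f - f)"
        by (intro tendsto_intros G F)
      then have "(\<lambda>i. K * norm (\<iota> (G i) - \<iota> (F i))) \<longlonglongrightarrow> 0" by simp
      then have "(\<lambda>i. g (G i) - g (F i)) \<longlonglongrightarrow> 0"
        by (rule Lim_null_comparison[rotated]) (simp add: diff[OF G(1) F(1)])
      from tendsto_add[OF this l] show ?thesis by simp
    qed
    then show ?thesis by blast
  qed
  then have "\<exists>T. \<forall>f G. (\<forall>i. G i \<in> A_tensor \<Omega>) \<longrightarrow> (\<lambda>i. \<iota> (G i)) \<longlonglongrightarrow> f \<longrightarrow> (\<lambda>i. g (G i)) \<longlonglongrightarrow> T f"
    by (intro choice allI)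
  then obtain T where T: "\<And>f G. (\<And>i. G i \<in> A_tensor \<Omega>) \<Longrightarrow> (\<lambda>i. \<iota> (G i)) \<longlonglongrightarrow> f \<Longrightarrow> (\<lambda>i. g (G i)) \<longlonglongrightarrow> T f"
    by blast
  have T_iota: "T (\<iota> F) = g F" if "F \<in> A_tensor \<Omega>" for F
    using T[of "\<lambda>i. F" "\<iota> F"] that by (simp add: LIMSEQ_const_iff)
  have T_norm: "norm (T f) \<le> K * norm f" for f
  proof -
    obtain F where F: "\<And>i. F i \<in> A_tensor \<Omega>" "(\<lambda>i. \<iota> (F i)) \<longlonglongrightarrow> f"
      using iota_approx by blast
    have "(\<lambda>i. norm (g (F i))) \<longlonglongrightarrow> norm (T f)" "(\<lambda>i. K * norm (\<iota> (F i))) \<longlonglongrightarrow> K * norm f"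
      by (intro tendsto_intros T F)+
    then show ?thesis
      by (rule LIMSEQ_le) (use bound[OF F(1)] in blast)
  qed
  have T_add: "T (f + f') = T f + T f'" for f f'
  proof -
    obtain F where F: "\<And>i. F i \<in> A_tensor \<Omega>" "(\<lambda>i. \<iota> (F i)) \<longlonglongrightarrow> f"
      using iota_approx by blast
    obtain F' where F': "\<And>i. F' i \<in> A_tensor \<Omega>" "(\<lambda>i. \<iota> (F' i)) \<longlonglongrightarrow> f'"
      using iota_approx by blast
    have "(\<lambda>i. g (\<lambda>z. F i z + F' i z)) \<longlonglongrightarrow> T (f + f')"
      using tendsto_add[OF F(2) F'(2)] by (intro T A_tensor_add F F') (simp add: iota_add F F')
    moreover have "(\<lambda>i. g (F i) + g (F' i)) \<longlonglongrightarrow> T f + T f'"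
      by (intro tendsto_add T F F')
    ultimately show ?thesis
      using LIMSEQ_unique by (simp add: add F(1) F'(1))
  qed
  have T_scale: "T (r *\<^sub>R f) = r *\<^sub>R T f" for r f
  proof -
    obtain F where F: "\<And>i. F i \<in> A_tensor \<Omega>" "(\<lambda>i. \<iota> (F i)) \<longlonglongrightarrow> f"
      using iota_approx by blast
    have "(\<lambda>i. g (\<lambda>z. complex_of_real r *s F i z)) \<longlonglongrightarrow> T (r *\<^sub>R f)"
      using tendsto_scaleR[OF tendsto_const F(2), of r]
      by (intro T A_tensor_scale F) (simp add: iota_scale F scaleC_of_real)
    moreover have "(\<lambda>i. r *\<^sub>R g (F i)) \<longlonglongrightarrow> r *\<^sub>R T f"
      by (intro tendsto_scaleR tendsto_const T F)
    ultimately show ?thesis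
      using LIMSEQ_unique by (simp add: scale F(1))
  qed
  have "bounded_linear T"
    by (rule bounded_linear_intro[where K = K]) (simp_all add: T_add T_scale T_norm mult.commute)
  then show thesis by (rule that[OF _ T_iota T_norm])
qed

lemma module_eval_props:
  assumes z: "z \<in> \<Omega>"
  shows ev_bounded_linear: "bounded_linear (ev z)"
    and ev_iota: "F \<in> A_tensor \<Omega> \<Longrightarrow> ev z (\<iota> F) = F z"
proof -
  obtain C where C: "\<And>F. F \<in> A_tensor \<Omega> \<Longrightarrow> norm (F z) \<le> C * norm (\<iota> F)"
    using eval_bounded z by (metis norm_iota)
  obtain T where T: "bounded_linear T" "\<And>F. F \<in> A_tensor \<Omega> \<Longrightarrow> T (\<iota> F) = F z"
    by (rule extend_from_A_tensor[of "\<lambda>F. F z" C]) (simp_all add: C vec_eq_iff scaleR_conv_of_real[where 'a = complex])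
  have "ev z = T"
    unfolding module_eval_def
  proof (rule the_equality)
    show "continuous_on UNIV T \<and> (\<forall>F\<in>A_tensor \<Omega>. T (\<iota> F) = F z)"
      using T by (simp add: linear_continuous_on)
    fix S assume S: "continuous_on UNIV S \<and> (\<forall>F\<in>A_tensor \<Omega>. S (\<iota> F) = F z)"
    have "S f = T f" for f
      by (rule dense_induct) (use S T in \<open>auto intro!: closed_Collect_eq linear_continuous_on\<close>)
    then show "S = T" by blast
  qed
  with T show "bounded_linear (ev z)" "F \<in> A_tensor \<Omega> \<Longrightarrow> ev z (\<iota> F) = F z"
    by simp_all
qed

lemma continuous_on_ev: "z \<in> \<Omega> \<Longrightarrow> continuous_on UNIV (ev z)"
  by (rule linear_continuous_on[OF ev_bounded_linear])

lemma ev_add: "z \<in> \<Omega> \<Longrightarrow> ev z (f + g) = ev z f + ev z g"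
  and ev_diff: "z \<in> \<Omega> \<Longrightarrow> ev z (f - g) = ev z f - ev z g"
  by (simp_all add: bounded_linear.linear linear_add linear_diff ev_bounded_linear)

lemma ev_scaleC:
  assumes z: "z \<in> \<Omega>"
  shows "ev z (c *\<^sub>C f) = c *s ev z f"
proof (rule dense_induct[where P = "\<lambda>f. ev z (c *\<^sub>C f) = c *s ev z f"])
  have "continuous_on UNIV (\<lambda>f. ev z (c *\<^sub>C f))"
    using bounded_linear_compose[OF ev_bounded_linear[OF z] bounded_linear_scaleC]
    by (rule linear_continuous_on)
  moreover have "continuous_on UNIV (\<lambda>f. c *s ev z f)"
    by (intro continuous_intros continuous_on_ev z)
  ultimately show "closed {f. ev z (c *\<^sub>C f) = c *s ev z f}"
    by (rule closed_Collect_eq)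
  fix F :: "complex^'n \<Rightarrow> complex^'m" assume F: "F \<in> A_tensor \<Omega>"
  then show "ev z (c *\<^sub>C \<iota> F) = c *s ev z (\<iota> F)"
    by (simp add: ev_iota[OF z] A_tensor_scale flip: iota_scale)
qed

lemma ev_norm_le:
  assumes z: "z \<in> \<Omega>" and C: "\<And>F. F \<in> A_tensor \<Omega> \<Longrightarrow> norm (F z) \<le> C * ip_norm ip F"
  shows "norm (ev z f) \<le> C * norm f"
proof (rule dense_induct[where P = "\<lambda>f. norm (ev z f) \<le> C * norm f"])
  show "closed {f. norm (ev z f) \<le> C * norm f}"
    by (intro closed_Collect_le continuous_intros continuous_on_ev z)
qed (simp add: ev_iota z norm_iota C)

text \<open>This is where the condition on Cauchy sequences in the module enters: a sequence in the tensor
product that converges to \<open>f\<close> is Cauchy and converges pointwise to zero, hence in norm.  So the elements of the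
module are determined by their values.\<close>

lemma ev_eq_0_imp:
  assumes "\<And>z. z \<in> \<Omega> \<Longrightarrow> ev z f = 0"
  shows "f = 0"
proof -
  obtain F where F: "\<And>i. F i \<in> A_tensor \<Omega>" "(\<lambda>i. \<iota> (F i)) \<longlonglongrightarrow> f"
    using iota_approx by blast
  have "(\<lambda>i. F i z) \<longlonglongrightarrow> 0" if z: "z \<in> \<Omega>" for z
  proof -
    have "(\<lambda>i. ev z (\<iota> (F i))) \<longlonglongrightarrow> ev z f"
      by (rule bounded_linear.tendsto[OF ev_bounded_linear[OF z] F(2)])
    then show ?thesis
      by (simp add: ev_iota[OF z F(1)] assms[OF z])
  qed
  moreover have "\<exists>N. \<forall>i\<ge>N. \<forall>j\<ge>N. ip_norm ip (\<lambda>z. F i z - F j z) < e" if "e > 0" for e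
    using metric_CauchyD[OF LIMSEQ_imp_Cauchy[OF F(2)] that]
    by (simp add: dist_norm norm_iota[OF A_tensor_diff[OF F(1) F(1)]] flip: iota_diff[OF F(1) F(1)])
  ultimately have "(\<lambda>i. ip_norm ip (F i)) \<longlonglongrightarrow> 0"
    using Cauchy_null_iff F(1) by blast
  then have "(\<lambda>i. \<iota> (F i)) \<longlonglongrightarrow> 0"
    using tendsto_norm_zero_cancel[of "\<lambda>i. \<iota> (F i)"] by (simp add: norm_iota F(1))
  with F(2) show ?thesis
    using LIMSEQ_unique by blast
qed

lemma ev_eqI:
  assumes "\<And>z. z \<in> \<Omega> \<Longrightarrow> ev z f = ev z g"
  shows "f = g"
  using ev_eq_0_imp[of "f - g"] assms by (simp add: ev_diff)

text \<open>Local uniform boundedness of the evaluations turns convergence in the module into locally uniform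
convergence of functions.\<close>

lemma module_element_continuous_on: "continuous_on \<Omega> (\<lambda>z. ev z f)"
proof (rule continuous_at_imp_continuous_on, rule ballI)
  fix z assume z: "z \<in> \<Omega>"
  obtain e C where e: "e > 0"
    and C: "\<And>w F. w \<in> ball z e \<inter> \<Omega> \<Longrightarrow> F \<in> A_tensor \<Omega> \<Longrightarrow> norm (F w) \<le> C * ip_norm ip F"
    using eval_locally_bounded z by metis
  let ?B = "ball z e \<inter> \<Omega>"
  obtain F where F: "\<And>i. F i \<in> A_tensor \<Omega>" "(\<lambda>i. \<iota> (F i)) \<longlonglongrightarrow> f"
    using iota_approx by blast
  have "continuous_on ?B (\<lambda>z. ev z f)"
  proof (rule uniform_limit_theorem)
    show "\<forall>\<^sub>F i in sequentially. continuous_on ?B (F i)"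
      by (intro always_eventually allI continuous_on_subset[OF A_tensor_continuous_on[OF F(1)]]) auto
    show "uniform_limit ?B F (\<lambda>z. ev z f) sequentially"
    proof (rule uniform_limitI)
      fix d :: real assume d: "d > 0"
      have "(\<lambda>i. C * norm (\<iota> (F i) - f)) \<longlonglongrightarrow> C * norm (f - f)"
        by (intro tendsto_intros F)
      then have "\<forall>\<^sub>F i in sequentially. C * norm (\<iota> (F i) - f) < d"
        using d by (intro order_tendstoD) auto
      then show "\<forall>\<^sub>F i in sequentially. \<forall>w\<in>?B. dist (F i w) (ev w f) < d"
      proof eventually_elim
        case (elim i)
        show ?case
        proof
          fix w assume w: "w \<in> ?B"
          have "dist (F i w) (ev w f) = norm (ev w (\<iota> (F i) - f))"
            using w by (simp add: dist_norm ev_diff ev_iota F(1))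
          also have "\<dots> \<le> C * norm (\<iota> (F i) - f)"
            using w C by (intro ev_norm_le) auto
          finally show "dist (F i w) (ev w f) < d" using elim by simp
        qed
      qed
    qed
  qed simp
  moreover have "open ?B" using domain_simps by auto
  ultimately show "isCont (\<lambda>z. ev z f) z"
    using z e by (simp add: continuous_on_eq_continuous_at)
qed

lemma A_alg_multiplier:
  assumes \<phi>: "\<phi> \<in> A_alg \<Omega>"
  obtains T :: "'r \<Rightarrow> 'r" where "\<And>f. norm (T f) \<le> sup_norm (closure \<Omega>) \<phi> * norm f"
    "\<And>f z. z \<in> \<Omega> \<Longrightarrow> ev z (T f) = \<phi> z *s ev z f"
proof -
  note mult = A_tensor_A_alg_mult[OF \<phi> _ domain_simps(3)]
  have scale: "(\<lambda>z. \<phi> z *s (c *s F z)) = (\<lambda>z. c *s (\<phi> z *s F z))" for c and F :: "complex^'n \<Rightarrow> complex^'m"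
    by (simp add: vector_smult_assoc mult.commute)
  have bound: "norm (\<iota> (\<lambda>z. \<phi> z *s F z)) \<le> sup_norm (closure \<Omega>) \<phi> * norm (\<iota> F)" if "F \<in> A_tensor \<Omega>" for F
    using mult_contractive \<phi> that mult[OF that] by (simp add: norm_iota)
  obtain T where T: "bounded_linear T" "\<And>F. F \<in> A_tensor \<Omega> \<Longrightarrow> T (\<iota> F) = \<iota> (\<lambda>z. \<phi> z *s F z)"
    "\<And>f. norm (T f) \<le> sup_norm (closure \<Omega>) \<phi> * norm f"
  proof (rule extend_from_A_tensor[of "\<lambda>F. \<iota> (\<lambda>z. \<phi> z *s F z)" "sup_norm (closure \<Omega>) \<phi>"])
    fix r and F :: "complex^'n \<Rightarrow> complex^'m" assume "F \<in> A_tensor \<Omega>"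
    then show "\<iota> (\<lambda>z. \<phi> z *s (complex_of_real r *s F z)) = r *\<^sub>R \<iota> (\<lambda>z. \<phi> z *s F z)"
      unfolding scale by (simp only: iota_scale mult scaleC_of_real)
  qed (simp_all add: bound vector_add_ldistrib iota_add mult)
  have "ev z (T f) = \<phi> z *s ev z f" if z: "z \<in> \<Omega>" for f z
  proof (rule dense_induct[where P = "\<lambda>f. ev z (T f) = \<phi> z *s ev z f"])
    have "continuous_on UNIV (\<lambda>f. ev z (T f))"
      using bounded_linear_compose[OF ev_bounded_linear[OF z] T(1)] by (rule linear_continuous_on)
    moreover have "continuous_on UNIV (\<lambda>f. \<phi> z *s ev z f)"
      by (intro continuous_intros continuous_on_ev z)
    ultimately show "closed {f. ev z (T f) = \<phi> z *s ev z f}"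
      by (rule closed_Collect_eq)
  qed (simp add: T(2) ev_iota z mult)
  then show thesis by (rule that[OF T(3)])
qed

end

section \<open>Multiplication by bounded holomorphic functions\<close>

locale bpwl_quasi_free = quasi_free \<Omega> ip \<iota>
  for \<Omega> :: "(complex^'n) set"
    and ip :: "(complex^'n \<Rightarrow> complex^'m) \<Rightarrow> (complex^'n \<Rightarrow> complex^'m) \<Rightarrow> complex"
    and \<iota> :: "(complex^'n \<Rightarrow> complex^'m) \<Rightarrow> 'r::chilbert_space" +
  assumes bpwl_dense: "strongly_bpwl_dense \<Omega>"
begin

text \<open>The multiples \<open>T\<^sub>i f\<close> of \<open>f\<close> by functions \<open>s\<^sub>i\<close> in the algebra that approximate \<open>\<phi>\<close> are bounded, and
their values converge to those of \<open>\<phi> f\<close>.  A weak limit is obtained as a common point of the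
closed convex hulls of the tails of the sequence; evaluations map these hulls into small balls
around the value of \<open>\<phi> f\<close>.\<close>

lemma H_inf_multiplier:
  assumes \<phi>: "\<phi> \<in> H_inf \<Omega>"
  shows "\<exists>T :: 'r \<Rightarrow>\<^sub>L 'r. \<forall>f. \<forall>z\<in>\<Omega>. ev z (T f) = \<phi> z *s ev z f"
proof -
  define K where "K = sup_norm \<Omega> \<phi>"
  obtain s where s: "\<And>i::nat. s i \<in> A_alg \<Omega>" "\<And>i. sup_norm (closure \<Omega>) (s i) \<le> K"
    "\<And>z. z \<in> \<Omega> \<Longrightarrow> (\<lambda>i. s i z) \<longlonglongrightarrow> \<phi> z"
    using bpwl_dense \<phi> unfolding strongly_bpwl_dense_def K_def by blast
  have "\<exists>T. (\<forall>f. norm (T f) \<le> K * norm f) \<and> (\<forall>f. \<forall>z\<in>\<Omega>. ev z (T f) = s i z *s ev z f)" for i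
    using A_alg_multiplier[OF s(1)[of i]] mult_right_mono[OF s(2)[of i] norm_ge_zero]
    by (metis order_trans)
  then obtain T :: "nat \<Rightarrow> 'r \<Rightarrow> 'r" where T: "\<And>i f. norm (T i f) \<le> K * norm f"
    "\<And>i f z. z \<in> \<Omega> \<Longrightarrow> ev z (T i f) = s i z *s ev z f"
    by metis
  have "\<exists>h. norm h \<le> K * norm f \<and> (\<forall>z\<in>\<Omega>. ev z h = \<phi> z *s ev z f)" for f
  proof -
    define C where "C n = closure (convex hull ((\<lambda>i. T i f) ` {n..}))" for n
    have C_least: "C n \<subseteq> S" if "closed S" "convex S" "\<And>i. i \<ge> n \<Longrightarrow> T i f \<in> S" for n S
      unfolding C_def using that by (intro closure_minimal hull_minimal) auto
    have T_in_C: "T n f \<in> C n" for n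
      unfolding C_def using hull_subset closure_subset by fastforce
    have "\<exists>h. \<forall>n. h \<in> C n"
    proof (rule nested_closed_convex[where K = "K * norm f"])
      show "decseq C"
        unfolding C_def by (intro decseq_SucI closure_mono hull_mono image_mono) auto
      show "\<exists>x\<in>C n. norm x \<le> K * norm f" for n
        using T_in_C T(1) by blast
    qed (simp_all add: C_def convex_closure)
    then obtain h where h: "\<And>n. h \<in> C n" by blast
    have "h \<in> cball 0 (K * norm f)"
      using C_least[of "cball 0 (K * norm f)" 0] h[of 0] T(1) by auto
    moreover have "ev z h = \<phi> z *s ev z f" if z: "z \<in> \<Omega>" for z
    proof -
      have "(\<lambda>i. s i z *s ev z f) \<longlonglongrightarrow> \<phi> z *s ev z f"
        by (intro tendsto_intros s z)
      then have lim: "(\<lambda>i. ev z (T i f)) \<longlonglongrightarrow> \<phi> z *s ev z f"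
        by (simp add: T(2)[OF z])
      have "dist (\<phi> z *s ev z f) (ev z h) \<le> e" if e: "e > 0" for e
      proof -
        obtain n where n: "\<And>i. i \<ge> n \<Longrightarrow> dist (ev z (T i f)) (\<phi> z *s ev z f) < e"
          using metric_LIMSEQ_D[OF lim e] by blast
        have "C n \<subseteq> ev z -` cball (\<phi> z *s ev z f) e"
        proof (rule C_least)
          show "closed (ev z -` cball (\<phi> z *s ev z f) e)"
            by (intro closed_vimage continuous_on_ev z) auto
          show "convex (ev z -` cball (\<phi> z *s ev z f) e)"
            by (intro convex_linear_vimage bounded_linear.linear ev_bounded_linear z) auto
        qed (use n in \<open>force simp: dist_commute\<close>)
        with h[of n] show ?thesis by auto
      qed
      then show ?thesis
        by (metis dist_le_zero_iff field_le_epsilon add_0)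
    qed
    ultimately show ?thesis by auto
  qed
  then obtain M where M: "\<And>f. norm (M f) \<le> K * norm f" "\<And>f z. z \<in> \<Omega> \<Longrightarrow> ev z (M f) = \<phi> z *s ev z f"
    by metis
  have "bounded_linear M"
  proof (rule bounded_linear_intro)
    show "M (f + g) = M f + M g" for f g
      by (rule ev_eqI) (simp add: M ev_add vector_add_ldistrib)
    show "M (r *\<^sub>R f) = r *\<^sub>R M f" for r f
      by (rule ev_eqI) (simp add: M ev_scaleC vector_smult_assoc mult.commute flip: scaleC_of_real)
    show "norm (M f) \<le> norm f * K" for f
      using M(1) by (simp add: mult.commute)
  qed
  then have "blinfun_apply (Blinfun M) = M"
    by (rule bounded_linear_Blinfun_apply)
  with M(2) show ?thesis by metis
qed

lemma mult_op_eqI: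
  fixes T :: "'r \<Rightarrow>\<^sub>L 'r"
  assumes "\<And>f z. z \<in> \<Omega> \<Longrightarrow> ev z (T f) = \<phi> z *s ev z f"
  shows "mult_op \<Omega> \<iota> \<phi> = T"
  unfolding mult_op_def
proof (rule the_equality)
  fix S :: "'r \<Rightarrow>\<^sub>L 'r" assume "\<forall>f. \<forall>z\<in>\<Omega>. ev z (S f) = \<phi> z *s ev z f"
  then show "S = T"
    using assms by (intro blinfun_eqI ev_eqI) simp
qed (use assms in blast)

lemma ev_mult_op:
  assumes "\<phi> \<in> H_inf \<Omega>" "z \<in> \<Omega>"
  shows "ev z (mult_op \<Omega> \<iota> \<phi> f) = \<phi> z *s ev z f"
  using H_inf_multiplier[OF assms(1)] mult_op_eqI assms(2) by metis

lemma mult_op_add: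
  assumes "\<phi> \<in> H_inf \<Omega>" "\<psi> \<in> H_inf \<Omega>"
  shows "mult_op \<Omega> \<iota> (\<lambda>z. \<phi> z + \<psi> z) = mult_op \<Omega> \<iota> \<phi> + mult_op \<Omega> \<iota> \<psi>"
  by (rule mult_op_eqI) (simp add: ev_mult_op assms blinfun.add_left ev_add vector_sadd_rdistrib)

lemma mult_op_mult:
  assumes "\<phi> \<in> H_inf \<Omega>" "\<psi> \<in> H_inf \<Omega>"
  shows "mult_op \<Omega> \<iota> (\<lambda>z. \<phi> z * \<psi> z) = mult_op \<Omega> \<iota> \<phi> o\<^sub>L mult_op \<Omega> \<iota> \<psi>"
  by (rule mult_op_eqI) (simp add: ev_mult_op assms vector_smult_assoc)

lemma mult_op_scale:
  assumes "\<phi> \<in> H_inf \<Omega>"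
  shows "mult_op \<Omega> \<iota> (\<lambda>z. c * \<phi> z) = scalar_op c o\<^sub>L mult_op \<Omega> \<iota> \<phi>"
  by (rule mult_op_eqI) (simp add: ev_mult_op assms ev_scaleC vector_smult_assoc)

lemma mult_op_one: "mult_op \<Omega> \<iota> (\<lambda>z. if z \<in> \<Omega> then 1 else 0) = id_blinfun"
  by (rule mult_op_eqI) simp

lemma mult_op_clinear:
  assumes "\<phi> \<in> H_inf \<Omega>"
  shows "mult_op \<Omega> \<iota> \<phi> (c *\<^sub>C f) = c *\<^sub>C mult_op \<Omega> \<iota> \<phi> f"
  by (rule ev_eqI) (simp add: ev_mult_op assms ev_scaleC vector_smult_assoc mult.commute)

text \<open>If \<open>\<phi> f = 0\<close>, then \<open>\<phi>\<close> vanishes wherever the continuous function \<open>f\<close> does not; if there were such a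
point, this would be on a whole ball, so that \<open>\<phi>\<close> would be zero.\<close>

lemma mult_op_injective:
  assumes \<phi>: "\<phi> \<in> H_inf \<Omega>" "\<phi> \<noteq> (\<lambda>z. 0)" and f: "mult_op \<Omega> \<iota> \<phi> f = 0"
  shows "f = 0"
proof (rule ev_eq_0_imp, rule ccontr)
  fix z assume z: "z \<in> \<Omega>" and nz: "ev z f \<noteq> 0"
  have prod: "\<phi> w = 0 \<or> ev w f = 0" if "w \<in> \<Omega>" for w
  proof -
    have "\<phi> w *s ev w f = ev w 0"
      using ev_mult_op[OF \<phi>(1) that, of f] f by simp
    also have "ev w 0 = 0"
      using ev_diff[OF that, of 0 0] by simp
    finally show ?thesis by simp
  qed
  have "isCont (\<lambda>z. ev z f) z"
    using module_element_continuous_on z domain_simps(1) by (simp add: continuous_on_eq_continuous_at)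
  then obtain d where d: "d > 0" "\<And>w. dist z w < d \<Longrightarrow> ev w f \<noteq> 0"
    using continuous_at_avoid[where f = "\<lambda>z. ev z f" and a = 0] nz by blast
  obtain r where r: "r > 0" "ball z r \<subseteq> \<Omega>"
    using openE[OF domain_simps(1) z] by blast
  have zero: "\<phi> u = 0" if "u \<in> ball z (min d r)" for u
    using prod[of u] d(2)[of u] r(2) that by auto
  have "\<phi> w = 0" if "w \<in> \<Omega>" for w
    by (rule identity_theorem_several[where \<Omega> = \<Omega> and z = z and e = "min d r"])
      (use \<phi>(1) domain_simps z d(1) r(1) zero that in \<open>auto simp: H_inf_def\<close>)
  moreover have "\<phi> w = 0" if "w \<notin> \<Omega>" for w
    using \<phi>(1) that by (simp add: H_inf_def)
  ultimately show False using \<phi>(2) by blast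
qed

section \<open>Characters of the Toeplitz algebra\<close>

lemma toeplitz_algebra_props:
  shows toeplitz_cstar: "cstar_operator_algebra (toeplitz_algebra \<Omega> \<iota>)"
    and mult_op_in_toeplitz: "\<phi> \<in> H_inf \<Omega> \<Longrightarrow> mult_op \<Omega> \<iota> \<phi> \<in> toeplitz_algebra \<Omega> \<iota>"
    and id_in_toeplitz: "id_blinfun \<in> toeplitz_algebra \<Omega> \<iota>"
proof -
  show "cstar_operator_algebra (toeplitz_algebra \<Omega> \<iota>)"
    unfolding toeplitz_algebra_def
    by (rule cstar_operator_algebra_hull) (auto simp: mult_op_clinear)
  show *: "mult_op \<Omega> \<iota> \<phi> \<in> toeplitz_algebra \<Omega> \<iota>" if "\<phi> \<in> H_inf \<Omega>" for \<phi>
    unfolding toeplitz_algebra_def using that by (intro hull_inc imageI)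
  show "id_blinfun \<in> toeplitz_algebra \<Omega> \<iota>"
    using *[OF H_inf_one[OF domain_simps(1)]] by (simp add: mult_op_one)
qed

lemma character_id:
  assumes "h \<in> characters (toeplitz_algebra \<Omega> \<iota>) (+) (o\<^sub>L) (\<lambda>c T. scalar_op c o\<^sub>L T)"
  shows "h id_blinfun = 1"
proof -
  obtain T where T: "T \<in> toeplitz_algebra \<Omega> \<iota>" "h T \<noteq> 0"
    using assms by (auto simp: characters_def)
  have "h (id_blinfun o\<^sub>L T) = h id_blinfun * h T"
    using assms T(1) id_in_toeplitz by (simp add: characters_def)
  moreover have "id_blinfun o\<^sub>L T = T"
    by (rule blinfun_eqI) simp
  ultimately show ?thesis using T(2) by simp
qed

lemma X_inf_subset: "X_inf \<Omega> \<iota> \<subseteq> max_ideal_space_H_inf \<Omega>"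
proof
  fix \<xi> assume "\<xi> \<in> X_inf \<Omega> \<iota>"
  then obtain h where h: "h \<in> characters (toeplitz_algebra \<Omega> \<iota>) (+) (o\<^sub>L) (\<lambda>c T. scalar_op c o\<^sub>L T)"
    and \<xi>: "\<xi> = (\<lambda>\<phi>. if \<phi> \<in> H_inf \<Omega> then h (mult_op \<Omega> \<iota> \<phi>) else 0)"
    unfolding X_inf_def by blast
  have "\<xi> (\<lambda>z. if z \<in> \<Omega> then 1 else 0) = 1"
    by (simp add: \<xi> H_inf_one domain_simps mult_op_one character_id[OF h])
  then have "\<exists>a\<in>H_inf \<Omega>. \<xi> a \<noteq> 0"
    using H_inf_one[OF domain_simps(1)] by (metis zero_neq_one)
  with h show "\<xi> \<in> max_ideal_space_H_inf \<Omega>"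
    unfolding max_ideal_space_H_inf_def characters_def \<xi>
    by (simp add: H_inf_add H_inf_mult H_inf_scale mult_op_add mult_op_mult mult_op_scale mult_op_in_toeplitz)
qed

text \<open>A character is multiplicative and takes the value one at the identity, so that it cannot vanish at
an operator with a left inverse in the algebra.\<close>

lemma X_inf_nonzero:
  assumes \<phi>: "\<phi> \<in> H_inf \<Omega>" "\<phi> \<noteq> (\<lambda>z. 0)" and closed: "closed (range (mult_op \<Omega> \<iota> \<phi>))"
    and \<xi>: "\<xi> \<in> X_inf \<Omega> \<iota>"
  shows "\<xi> \<phi> \<noteq> 0"
proof -
  obtain h where h: "h \<in> characters (toeplitz_algebra \<Omega> \<iota>) (+) (o\<^sub>L) (\<lambda>c T. scalar_op c o\<^sub>L T)"
    and \<xi>: "\<xi> \<phi> = h (mult_op \<Omega> \<iota> \<phi>)"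
    using \<xi> \<phi>(1) unfolding X_inf_def by auto
  obtain c where c: "c > 0" "\<And>f. c * norm f \<le> norm (mult_op \<Omega> \<iota> \<phi> f)"
    using injective_closed_range_bounded_below[OF blinfun.bounded_linear_right mult_op_injective[OF \<phi>] closed]
    by blast
  obtain S where S: "S \<in> toeplitz_algebra \<Omega> \<iota>" "S o\<^sub>L mult_op \<Omega> \<iota> \<phi> = id_blinfun"
    using left_inverse_in_cstar_operator_algebra[OF toeplitz_cstar id_in_toeplitz mult_op_in_toeplitz[OF \<phi>(1)] c]
    by blast
  have "h S * h (mult_op \<Omega> \<iota> \<phi>) = h (S o\<^sub>L mult_op \<Omega> \<iota> \<phi>)"
    using h S(1) mult_op_in_toeplitz[OF \<phi>(1)] by (simp add: characters_def)
  also have "\<dots> = 1"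
    using S(2) character_id[OF h] by simp
  finally show ?thesis using \<xi> by auto
qed

end

theorem proposition6p3:
  fixes \<Omega> :: "(complex^'n) set"
    and ip :: "(complex^'n \<Rightarrow> complex^'m) \<Rightarrow> (complex^'n \<Rightarrow> complex^'m) \<Rightarrow> complex"
    and \<iota> :: "(complex^'n \<Rightarrow> complex^'m) \<Rightarrow> 'r::chilbert_space"
    and \<phi> :: "complex^'n \<Rightarrow> complex"
  assumes "bounded_domain \<Omega>"
    and "strongly_bpwl_dense \<Omega>"
    and "quasi_free_module \<Omega> ip \<iota>"
    and "\<phi> \<in> H_inf \<Omega>"
    and "\<phi> \<noteq> (\<lambda>z. 0)"
    and "closed (range (blinfun_apply (mult_op \<Omega> \<iota> \<phi>)))"
  shows "invertible_in_C (X_inf \<Omega> \<iota>) (gelfand \<Omega> \<phi>)"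
proof -
  interpret bpwl_quasi_free \<Omega> ip \<iota>
    using assms(1-3) by unfold_locales
  have eval: "continuous_on (X_inf \<Omega> \<iota>) (\<lambda>\<xi>. \<xi> \<phi>)"
    by (rule continuous_on_subset[OF continuous_on_product_coordinates]) simp
  have gelfand_eq: "gelfand \<Omega> \<phi> \<xi> = \<xi> \<phi>" if "\<xi> \<in> X_inf \<Omega> \<iota>" for \<xi>
    using X_inf_subset that by (auto simp: gelfand_def)
  have nonzero: "\<xi> \<phi> \<noteq> 0" if "\<xi> \<in> X_inf \<Omega> \<iota>" for \<xi>
    using X_inf_nonzero assms(4-6) that by blast
  have "continuous_on (X_inf \<Omega> \<iota>) (gelfand \<Omega> \<phi>)"
    using eval by (rule continuous_on_eq) (simp add: gelfand_eq)
  moreover have "continuous_on (X_inf \<Omega> \<iota>) (\<lambda>\<xi>. inverse (\<xi> \<phi>))"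
    using nonzero by (intro continuous_on_inverse eval) auto
  ultimately show ?thesis
    unfolding invertible_in_C_def
    by (intro conjI exI[of _ "\<lambda>\<xi>. inverse (\<xi> \<phi>)"]) (simp_all add: gelfand_eq nonzero)
qed

end
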